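(* For every $u\in H^{1/2}_+$, $$E(u)\le Q(u)\,(Q(u)+2M(u)),$$ i.e. $$\|u\|_{L^4}^4\le\|u\|_{L^2}^2\left(\|u\|_{L^2}^2+\|u\|_{H^{1/2}}^2\right),$$ with equality if and only if $u\in\mathcal M(1)$.
   Context: $\mathbb S^1$ is the unit circle in $\mathbb C$; $H^{1/2}_+$ is the space of $u\in H^{1/2}(\mathbb S^1)$ with Fourier coefficients $\hat u(k)=0$ for all $k<0$. The functionals are $E(u)=\int_{\mathbb S^1}|u|^4\frac{d\theta}{2\pi}=\|u\|_{L^4}^4$, $Q(u)=\int_{\mathbb S^1}|u|^2\frac{d\theta}{2\pi}=\|u\|_{L^2}^2$, and $M(u)=(Du|u)=\sum_{k\ge0}k|\hat u(k)|^2$, where $D=-i\partial_\theta$ and $(u|v)=\int_{\mathbb S^1}u\overline v\,\frac{d\theta}{2\pi}$. The paper writes $\|u\|_{H^{1/2}}^2=\sum_{k\ge0}(k+1)|\hat u(k)|^2=M(u)+Q(u)$. $\mathcal M(1)$ is the set of functions $\varphi_{\alpha,p}(z)=\frac{\alpha}{1-pz}$ with $\alpha\in\mathbb C$, $\alpha\ne0$, and $p\in\mathbb C$, $|p|<1$.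
   Formalization: Equality is stated as "u in M(1) or u = 0 a.e.", since u = 0 also gives equality; the norm form has right side ||u||_{L^2}^2 (2||u||_{H^{1/2}}^2 - ||u||_{L^2}^2), since with ||u||_{H^{1/2}}^2 = M+Q the display as written is false (u = 1/(1-pz), |p|^2 = 3/4: 112 > 80). *)

theory Defs
  imports "HOL-Analysis.Analysis"
begin

text \<open>
  Functions on the unit circle are represented by maps \<open>complex \<Rightarrow> complex\<close>. The measure below lives
  on the subspace \<open>sphere 0 1\<close>, so measurability, integrals and almost-everywhere statements do not
  depend on the values off the circle. Elements of the function spaces are representatives of
  almost-everywhere classes.
\<close>

definition circle :: "complex measure" where
  "circle = distr (uniform_measure lborel {0..<2 * pi}) (restrict_space borel (sphere 0 1)) cis"

text \<open>On the unit circle, \<open>z powi (-k)\<close> is \<open>exp (- \<i> k \<theta>)\<close>.\<close>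

definition fourier_coeff :: "(complex \<Rightarrow> complex) \<Rightarrow> int \<Rightarrow> complex" where
  "fourier_coeff u k = (LINT z|circle. u z * z powi (-k))"

definition H_half :: "(complex \<Rightarrow> complex) set" where
  "H_half = {u. u \<in> borel_measurable circle \<and>
                integrable circle (\<lambda>z. (cmod (u z))\<^sup>2) \<and>
                (\<lambda>k::int. (1 + \<bar>real_of_int k\<bar>) * (cmod (fourier_coeff u k))\<^sup>2) summable_on UNIV}"

definition H_half_plus :: "(complex \<Rightarrow> complex) set" where
  "H_half_plus = {u \<in> H_half. \<forall>k<0. fourier_coeff u k = 0}"

definition E :: "(complex \<Rightarrow> complex) \<Rightarrow> real" where
  "E u = (LINT z|circle. cmod (u z) ^ 4)"

definition Q :: "(complex \<Rightarrow> complex) \<Rightarrow> real" where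
  "Q u = (LINT z|circle. (cmod (u z))\<^sup>2)"

definition M :: "(complex \<Rightarrow> complex) \<Rightarrow> real" where
  "M u = (\<Sum>k. real k * (cmod (fourier_coeff u (int k)))\<^sup>2)"

definition Lp_norm :: "real \<Rightarrow> (complex \<Rightarrow> complex) \<Rightarrow> real" where
  "Lp_norm p u = (LINT z|circle. cmod (u z) powr p) powr (1 / p)"

text \<open>This is the norm on \<^const>\<open>H_half_plus\<close> only: negative frequencies are not counted.\<close>

definition H_half_norm :: "(complex \<Rightarrow> complex) \<Rightarrow> real" where
  "H_half_norm u = sqrt (\<Sum>k. (real k + 1) * (cmod (fourier_coeff u (int k)))\<^sup>2)"

definition M_one :: "(complex \<Rightarrow> complex) set" where
  "M_one = {u. \<exists>\<alpha> p. \<alpha> \<noteq> 0 \<and> cmod p < 1 \<and> (AE z in circle. u z = \<alpha> / (1 - p * z))}"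

end

theory Submission
  imports Defs
begin

text \<open>
  Write \<open>a\<^sub>k\<close> for the Fourier coefficients of \<open>u\<close>. The coefficient of \<open>u\<^sup>2\<close> at \<open>n\<close> is the sum
  of the \<open>n + 1\<close> products \<open>a\<^sub>j a\<^sub>n\<^sub>-\<^sub>j\<close>, so Parseval's identity for \<open>u\<^sup>2\<close> and the Cauchy-Schwarz
  inequality for each \<open>n\<close> bound \<open>E u\<close> by the sum of \<open>(j + k + 1) |a\<^sub>j|\<^sup>2 |a\<^sub>k|\<^sup>2\<close> over all \<open>j, k\<close>, which
  is \<open>Q u * (Q u + 2 * M u)\<close>. Equality forces \<open>a\<^sub>j a\<^sub>n\<^sub>-\<^sub>j = a\<^sub>0 a\<^sub>n\<close> for all \<open>j \<le> n\<close>, that is, \<open>a\<close> is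
  zero or a geometric progression. That \<open>|u|\<^sup>4\<close> is integrable at all follows by Fatou's lemma from the
  same bound for the partial sums of the Fourier series.
\<close>

subsection \<open>Square integrable functions on the circle\<close>

text \<open>The obstacle is that for a square integrable \<open>u\<close> the function u^2 is a
  priori only integrable. Its coefficients are therefore computed by an approximation in one factor
  only, and Parseval for u^2 is available only once |u|^4 is known to be integrable. Partial sums
  are bounded, so they satisfy this condition automatically. After Fatou the estimate is run again
  on \<open>u\<close> itself, because a limit of inequalities would lose the equality case. The
  weight j + k + 1 is the number n + 1 of terms on the diagonal j + k = n; read as 1 + j + k, it
  yields Q^2 from the 1 and one product M Q from each of j and k, which is where the constant 2
  comes from. Equality can be analysed because the total defect is a series of nonnegative defects,
  one for each diagonal. Parseval rests on the density of trigonometric polynomials, obtained by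
  enlarging the class of approximable functions: continuous, indicator, simple, square
  integrable.\<close>

lemma measurable_cis_circle:
  "cis \<in> measurable (uniform_measure lborel {0..<2 * pi}) (restrict_space borel (sphere 0 1))"
proof (rule measurable_restrict_space2)
  have "cis \<in> borel_measurable borel"
    by (rule borel_measurable_continuous_onI) (auto intro!: continuous_intros)
  then show "cis \<in> borel_measurable (uniform_measure lborel {0..<2 * pi})"
    by simp
qed auto

lemma space_circle [simp]: "space circle = sphere 0 1"
  by (simp add: circle_def space_restrict_space)

lemma sets_circle [measurable_cong]: "sets circle = sets (restrict_space borel (sphere 0 1))"
  by (simp add: circle_def)

lemma emeasure_circle_space: "emeasure circle (sphere 0 1) = 1"
proof -
  have "emeasure circle (sphere 0 1)
      = emeasure (uniform_measure lborel {0..<2 * pi}) (space (uniform_measure lborel {0..<2 * pi}))"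
    unfolding circle_def
    by (subst emeasure_distr[OF measurable_cis_circle])
       (auto simp: sets_restrict_space_iff vimage_def intro!: arg_cong[where f = "emeasure _"])
  also have "\<dots> = 1"
    by (simp add: emeasure_uniform_measure divide_ennreal)
  finally show ?thesis .
qed

interpretation circle: finite_measure circle
  by (rule finite_measureI) (simp add: emeasure_circle_space)

lemma measure_circle_space [simp]: "measure circle (sphere 0 1) = 1"
  by (simp add: measure_def emeasure_circle_space)

lemma continuous_on_circle_measurable:
  "continuous_on (sphere 0 1) f \<Longrightarrow> f \<in> borel_measurable circle"
  unfolding measurable_cong_sets[OF sets_circle refl]
  by (rule borel_measurable_continuous_on_restrict)

lemma powi_measurable_circle [measurable]: "(\<lambda>z. z powi k) \<in> borel_measurable circle"
  by (rule continuous_on_circle_measurable) (auto intro!: continuous_intros)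

lemma cmod_powi_circle: "cmod z = 1 \<Longrightarrow> cmod (z powi k) = 1"
  by (simp add: norm_power_int)

lemma cnj_circle: "cmod z = 1 \<Longrightarrow> cnj z = inverse z"
  by (metis complex_norm_square inverse_unique of_real_1 power_one)

lemma cnj_powi_circle: "cmod z = 1 \<Longrightarrow> cnj (z powi k) = z powi (-k)"
  using cnj_circle[OF cmod_powi_circle] by (simp add: power_int_minus)

text \<open>All orthogonality relations are contained in this one integral, since products and
  conjugates of powers of z on the circle are again powers. For nonzero \<open>k\<close> the
  pulled-back integrand has the 2 pi-periodic primitive \<open>F\<close>.\<close>

lemma integral_powi_circle: "(LINT z|circle. z powi k) = of_bool (k = 0)"
proof (cases "k = 0")
  case True
  then show ?thesis by simp
next
  case False
  define F where "F = (\<lambda>x. - \<i> / of_int k * cis (of_int k * x))"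
  have der: "(F has_vector_derivative cis (of_int k * x)) (at x within {0..2*pi})" for x
  proof -
    have "((\<lambda>w. - \<i> / of_int k * exp (\<i> * of_int k * w)) has_field_derivative
        exp (\<i> * of_int k * of_real x)) (at (of_real x))"
      using False by (auto intro!: derivative_eq_intros)
    from has_vector_derivative_real_field[OF this]
    show ?thesis by (simp add: F_def cis_conv_exp mult_ac)
  qed
  have "(\<integral>x. indicator {0..2*pi} x *\<^sub>R cis (of_int k * x) \<partial>lborel) = F (2*pi) - F 0"
    by (rule integral_FTC_Icc[OF _ der]) (auto intro!: continuous_intros)
  also have "\<dots> = 0"
    using cis_multiple_2pi[of "of_int k"] by (simp add: F_def mult_ac)
  finally have *: "(\<integral>x. indicator {0..2*pi} x *\<^sub>R cis (of_int k * x) \<partial>lborel) = 0" .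
  have [measurable]: "(\<lambda>x. cis (of_int k * x)) \<in> borel_measurable borel"
    by (auto intro!: borel_measurable_continuous_onI continuous_intros)
  have "(LINT z|circle. z powi k) = (LINT x|uniform_measure lborel {0..<2*pi}. cis x powi k)"
    unfolding circle_def
    by (rule integral_distr[OF measurable_cis_circle])
       (use powi_measurable_circle[of k] in \<open>simp add: measurable_cong_sets[OF sets_circle refl]\<close>)
  also have "uniform_measure lborel {0..<2*pi}
      = density lborel (\<lambda>x. ennreal (indicator {0..<2*pi} x / (2 * pi)))"
    unfolding uniform_measure_def
    using divide_ennreal[of 1 "2 * pi"] by (intro density_cong) (auto split: split_indicator)
  also have "(LINT x|\<dots>. cis x powi k)
      = (LINT x|lborel. (indicator {0..<2*pi} x / (2 * pi)) *\<^sub>R cis x powi k)"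
    by (rule integral_density) (auto simp: Complex.cis_power_int)
  \<comment> \<open>The fundamental theorem was applied on the closed interval; the added endpoint
    is a null set.\<close>
  also have "\<dots> = (LINT x|lborel. (1 / (2 * pi)) *\<^sub>R (indicator {0..2*pi} x *\<^sub>R cis (of_int k * x)))"
    using AE_lborel_singleton[of "2 * pi"]
    by (intro integral_cong_AE)
       (auto simp: Complex.cis_power_int split: split_indicator)
  also have "\<dots> = 0"
    by (subst integral_scaleR_right) (simp add: *)
  finally show ?thesis using False by simp
qed

text \<open>Representatives of L^2 classes. \<open>Q\<close> is the squared norm, and the Hilbert
  space arguments are phrased through \<open>Q\<close> alone.\<close>

definition square_integrable :: "(complex \<Rightarrow> complex) set" where
  "square_integrable = {f \<in> borel_measurable circle. integrable circle (\<lambda>z. (cmod (f z))\<^sup>2)}"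

lemma square_integrableD:
  assumes "f \<in> square_integrable"
  shows "f \<in> borel_measurable circle" "integrable circle (\<lambda>z. (cmod (f z))\<^sup>2)"
  using assms by (auto simp: square_integrable_def)

lemma square_integrable_bounded:
  assumes [measurable]: "f \<in> borel_measurable circle" and "\<And>z. cmod z = 1 \<Longrightarrow> cmod (f z) \<le> B"
  shows "f \<in> square_integrable"
proof -
  have "integrable circle (\<lambda>z. (cmod (f z))\<^sup>2)"
    by (rule circle.integrable_const_bound[of _ "B\<^sup>2"])
       (use assms(2) in \<open>auto simp: power_mono\<close>)
  then show ?thesis
    using assms(1) by (simp add: square_integrable_def)
qed

lemma square_integrable_powi: "(\<lambda>z. z powi k) \<in> square_integrable"
  by (rule square_integrable_bounded[of _ 1]) (auto simp: cmod_powi_circle)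

lemma square_integrable_const: "(\<lambda>z. c) \<in> square_integrable"
  by (rule square_integrable_bounded[of _ "cmod c"]) auto

lemma square_integrable_mult_bounded:
  assumes f: "f \<in> square_integrable" and [measurable]: "g \<in> borel_measurable circle"
    and B: "\<And>z. cmod z = 1 \<Longrightarrow> cmod (g z) \<le> B"
  shows "(\<lambda>z. g z * f z) \<in> square_integrable"
proof -
  note [measurable] = square_integrableD(1)[OF f]
  have "integrable circle (\<lambda>z. (cmod (g z * f z))\<^sup>2)"
  proof (rule Bochner_Integration.integrable_bound)
    show "integrable circle (\<lambda>z. B\<^sup>2 * (cmod (f z))\<^sup>2)"
      using square_integrableD(2)[OF f] by simp
    show "AE z in circle. norm ((cmod (g z * f z))\<^sup>2) \<le> norm (B\<^sup>2 * (cmod (f z))\<^sup>2)"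
      by (rule AE_I2) (auto simp: norm_mult power_mult_distrib intro!: mult_right_mono power_mono B)
  qed measurable
  then show ?thesis by (simp add: square_integrable_def)
qed

lemma square_integrable_cmult:
  "f \<in> square_integrable \<Longrightarrow> (\<lambda>z. c * f z) \<in> square_integrable"
  by (rule square_integrable_mult_bounded[where B = "cmod c"]) auto

lemma cmod_add_square_le: "(cmod (a + b))\<^sup>2 \<le> 2 * (cmod a)\<^sup>2 + 2 * (cmod b)\<^sup>2"
proof -
  have "(cmod (a + b))\<^sup>2 \<le> (cmod a + cmod b)\<^sup>2"
    by (intro power_mono norm_triangle_ineq) auto
  also have "\<dots> \<le> 2 * (cmod a)\<^sup>2 + 2 * (cmod b)\<^sup>2"
    using zero_le_power2[of "cmod a - cmod b"] by (simp add: power2_eq_square algebra_simps)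
  finally show ?thesis .
qed

lemma square_integrable_add:
  assumes f: "f \<in> square_integrable" and g: "g \<in> square_integrable"
  shows "(\<lambda>z. f z + g z) \<in> square_integrable"
proof -
  note [measurable] = square_integrableD(1)[OF f] square_integrableD(1)[OF g]
  have "integrable circle (\<lambda>z. (cmod (f z + g z))\<^sup>2)"
  proof (rule Bochner_Integration.integrable_bound)
    show "integrable circle (\<lambda>z. 2 * (cmod (f z))\<^sup>2 + 2 * (cmod (g z))\<^sup>2)"
      using square_integrableD(2)[OF f] square_integrableD(2)[OF g] by simp
    show "AE z in circle. norm ((cmod (f z + g z))\<^sup>2) \<le> norm (2 * (cmod (f z))\<^sup>2 + 2 * (cmod (g z))\<^sup>2)"
      using cmod_add_square_le by (intro AE_I2) simp
  qed measurable
  then show ?thesis by (simp add: square_integrable_def)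
qed

lemma square_integrable_diff:
  assumes f: "f \<in> square_integrable" and g: "g \<in> square_integrable"
  shows "(\<lambda>z. f z - g z) \<in> square_integrable"
  using square_integrable_add[OF f square_integrable_cmult[OF g, of "-1"]] by simp

lemma square_integrable_sum:
  "(\<And>i. i \<in> A \<Longrightarrow> f i \<in> square_integrable) \<Longrightarrow> (\<lambda>z. \<Sum>i\<in>A. f i z) \<in> square_integrable"
  by (induction A rule: infinite_finite_induct)
     (auto intro!: square_integrable_add square_integrable_const)

lemma Q_nonneg: "Q f \<ge> 0"
  by (simp add: Q_def)

lemma Q_cmult: "Q (\<lambda>z. c * f z) = (cmod c)\<^sup>2 * Q f"
  by (simp add: Q_def norm_mult power_mult_distrib)

text \<open>Replaces the triangle inequality of the L^2 norm without square roots. Its factor 2 is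
  the reason why approximation arguments with two errors aim at \<open>e / 4\<close>.\<close>

lemma Q_add_le:
  assumes f: "f \<in> square_integrable" and g: "g \<in> square_integrable"
  shows "Q (\<lambda>z. f z + g z) \<le> 2 * Q f + 2 * Q g"
proof -
  have "Q (\<lambda>z. f z + g z) \<le> (LINT z|circle. 2 * (cmod (f z))\<^sup>2 + 2 * (cmod (g z))\<^sup>2)"
    unfolding Q_def
    using square_integrableD(2)[OF f] square_integrableD(2)[OF g]
      square_integrableD(2)[OF square_integrable_add[OF f g]]
    by (intro integral_mono cmod_add_square_le) auto
  also have "\<dots> = 2 * Q f + 2 * Q g"
    using square_integrableD(2)[OF f] square_integrableD(2)[OF g] by (simp add: Q_def)
  finally show ?thesis .
qed

section \<open>The bilinear pairing and the Cauchy-Schwarz inequality\<close>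

lemma integrable_mult_square_integrable:
  assumes f: "f \<in> square_integrable" and g: "g \<in> square_integrable"
  shows "integrable circle (\<lambda>z. f z * g z)"
proof (rule Bochner_Integration.integrable_bound)
  note [measurable] = square_integrableD(1)[OF f] square_integrableD(1)[OF g]
  show "integrable circle (\<lambda>z. (cmod (f z))\<^sup>2 + (cmod (g z))\<^sup>2)"
    using square_integrableD(2)[OF f] square_integrableD(2)[OF g] by simp
  have "cmod a * cmod b \<le> (cmod a)\<^sup>2 + (cmod b)\<^sup>2" for a b
    using sum_squares_bound[of "cmod a" "cmod b"]
      mult_nonneg_nonneg[OF norm_ge_zero[of a] norm_ge_zero[of b]] by linarith
  then show "AE z in circle. norm (f z * g z) \<le> norm ((cmod (f z))\<^sup>2 + (cmod (g z))\<^sup>2)"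
    by (intro AE_I2) (simp add: norm_mult)
  show "(\<lambda>z. f z * g z) \<in> borel_measurable circle" by measurable
qed

text \<open>The discriminant argument for the integral of (s |f| - |g|)^2. The pairing carries no
  conjugate because it is applied to Fourier coefficients of products.\<close>

lemma Cauchy_Schwarz_circle:
  assumes f: "f \<in> square_integrable" and g: "g \<in> square_integrable"
  shows "(cmod (LINT z|circle. f z * g z))\<^sup>2 \<le> Q f * Q g"
proof -
  define c where "c = (LINT z|circle. cmod (f z) * cmod (g z))"
  note int = square_integrableD(2)[OF f] square_integrableD(2)[OF g]
  have int': "integrable circle (\<lambda>z. cmod (f z) * cmod (g z))"
    using integrable_norm[OF integrable_mult_square_integrable[OF f g]] by (simp add: norm_mult)
  have quad: "0 \<le> s\<^sup>2 * Q f - 2 * s * c + Q g" for s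
  proof -
    have "0 \<le> (LINT z|circle. (s * cmod (f z) - cmod (g z))\<^sup>2)"
      by simp
    also have "\<dots> = (LINT z|circle. s\<^sup>2 * (cmod (f z))\<^sup>2 - 2 * s * (cmod (f z) * cmod (g z)) + (cmod (g z))\<^sup>2)"
      by (intro Bochner_Integration.integral_cong) (simp_all add: power2_diff power_mult_distrib)
    also have "\<dots> = s\<^sup>2 * Q f - 2 * s * c + Q g"
      using int int' by (simp add: Q_def c_def)
    finally show ?thesis .
  qed
  have "c\<^sup>2 \<le> Q f * Q g"
  proof (cases "Q f = 0")
    case True
    have "c = 0"
    proof (rule ccontr)
      assume "c \<noteq> 0"
      \<comment> \<open>With \<open>Q f = 0\<close> the quadratic is affine in \<open>s\<close>;
        this \<open>s\<close> gives it the value -1.\<close>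
      then show False
        using quad[of "(Q g + 1) / (2 * c)"] True by simp
    qed
    then show ?thesis using True by simp
  next
    case False
    then have "Q f > 0" using Q_nonneg[of f] by simp
    \<comment> \<open>\<open>c / Q f\<close> is the minimiser of the quadratic.\<close>
    then show ?thesis
      using quad[of "c / Q f"] by (simp add: field_simps power2_eq_square)
  qed
  moreover have "cmod (LINT z|circle. f z * g z) \<le> c"
    using integral_norm_bound[of circle "\<lambda>z. f z * g z"] by (simp add: c_def norm_mult)
  ultimately show ?thesis
    by (meson norm_ge_zero order_trans power_mono)
qed

section \<open>Fourier coefficients and Bessel's inequality\<close>

lemma fourier_coeff_cmult: "fourier_coeff (\<lambda>z. c * f z) k = c * fourier_coeff f k"
  by (simp add: fourier_coeff_def mult.assoc)

lemma fourier_coeff_diff: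
  assumes "f \<in> square_integrable" "g \<in> square_integrable"
  shows "fourier_coeff (\<lambda>z. f z - g z) k = fourier_coeff f k - fourier_coeff g k"
  using assms[THEN integrable_mult_square_integrable[OF _ square_integrable_powi[of "-k"]]]
  by (simp add: fourier_coeff_def left_diff_distrib)

lemma fourier_coeff_sum:
  assumes "\<And>i. i \<in> A \<Longrightarrow> f i \<in> square_integrable"
  shows "fourier_coeff (\<lambda>z. \<Sum>i\<in>A. f i z) k = (\<Sum>i\<in>A. fourier_coeff (f i) k)"
  using assms[THEN integrable_mult_square_integrable[OF _ square_integrable_powi[of "-k"]]]
  by (simp add: fourier_coeff_def sum_distrib_right)

lemma fourier_coeff_cong_AE:
  assumes "f \<in> borel_measurable circle" "g \<in> borel_measurable circle" "AE z in circle. f z = g z"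
  shows "fourier_coeff f k = fourier_coeff g k"
  unfolding fourier_coeff_def using assms by (intro integral_cong_AE) auto

lemma fourier_coeff_powi_mult: "fourier_coeff (\<lambda>z. z powi j * f z) k = fourier_coeff f (k - j)"
  unfolding fourier_coeff_def
proof (rule Bochner_Integration.integral_cong)
  fix z assume "z \<in> space circle"
  then have "z \<noteq> 0" by auto
  then have eq: "z powi (-(k - j)) = z powi j * z powi (-k)"
    by (simp flip: power_int_add)
  show "z powi j * f z * z powi (-k) = f z * z powi (-(k - j))"
    unfolding eq by (simp only: mult_ac)
qed simp

lemma fourier_coeff_const: "fourier_coeff (\<lambda>z. c) k = (if k = 0 then c else 0)"
  by (simp add: fourier_coeff_def integral_powi_circle)

lemma fourier_coeff_powi: "fourier_coeff (\<lambda>z. z powi j) k = of_bool (k = j)"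
  using fourier_coeff_powi_mult[of j "\<lambda>_. 1" k] by (simp add: fourier_coeff_const)

lemma square_integrable_trig: "(\<lambda>z. \<Sum>k\<in>A. c k * z powi k) \<in> square_integrable"
  by (intro square_integrable_sum square_integrable_cmult square_integrable_powi)

lemma fourier_coeff_trig:
  assumes "finite A"
  shows "fourier_coeff (\<lambda>z. \<Sum>j\<in>A. c j * z powi j) k = (if k \<in> A then c k else 0)"
proof -
  have "fourier_coeff (\<lambda>z. \<Sum>j\<in>A. c j * z powi j) k = (\<Sum>j\<in>A. c j * of_bool (k = j))"
    by (subst fourier_coeff_sum)
       (simp_all add: fourier_coeff_cmult fourier_coeff_powi square_integrable_cmult square_integrable_powi)
  also have "\<dots> = (\<Sum>j\<in>A. if k = j then c j else 0)"
    by (intro sum.cong) auto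
  finally show ?thesis using assms by simp
qed

lemma cmod_diff_square: "(cmod (a - b))\<^sup>2 = (cmod a)\<^sup>2 - 2 * Re (cnj b * a) + (cmod b)\<^sup>2"
  unfolding cmod_power2 by (simp add: power2_eq_square algebra_simps)

text \<open>Completing the square in \<open>c\<close>: the cross term of the expanded integrand
  integrates to the real part of \<open>cnj c * fourier_coeff g k\<close>.\<close>

lemma Q_diff_monomial:
  assumes g: "g \<in> square_integrable"
  shows "Q (\<lambda>z. g z - c * z powi k)
    = Q g - (cmod (fourier_coeff g k))\<^sup>2 + (cmod (fourier_coeff g k - c))\<^sup>2"
proof -
  note int = integrable_mult_square_integrable[OF g square_integrable_powi[of "-k"]]
  have int': "integrable circle (\<lambda>z. cnj c * (g z * z powi (-k)))"
    using int by simp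
  have coeff: "(LINT z|circle. cnj c * (g z * z powi (-k))) = cnj c * fourier_coeff g k"
    unfolding fourier_coeff_def by (rule integral_mult_right_zero)
  have "Q (\<lambda>z. g z - c * z powi k)
      = (LINT z|circle. (cmod (g z))\<^sup>2 - 2 * Re (cnj c * (g z * z powi (-k))) + (cmod c)\<^sup>2)"
    unfolding Q_def
  proof (rule Bochner_Integration.integral_cong)
    fix z assume "z \<in> space circle"
    then have z: "cmod z = 1" by simp
    have "cnj (c * z powi k) * g z = cnj c * (g z * z powi (-k))"
      by (simp only: complex_cnj_mult cnj_powi_circle[OF z] mult_ac)
    then show "(cmod (g z - c * z powi k))\<^sup>2
        = (cmod (g z))\<^sup>2 - 2 * Re (cnj c * (g z * z powi (-k))) + (cmod c)\<^sup>2"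
      by (simp only: cmod_diff_square norm_mult cmod_powi_circle[OF z] mult_1_right)
  qed simp
  also have "\<dots> = Q g - 2 * Re (cnj c * fourier_coeff g k) + (cmod c)\<^sup>2"
    unfolding coeff[symmetric] integral_Re[OF int', symmetric] Q_def
    using square_integrableD(2)[OF g] integrable_Re[OF int']
    by (simp del: times_complex.sel)
  also have "\<dots> = Q g - (cmod (fourier_coeff g k))\<^sup>2 + (cmod (fourier_coeff g k - c))\<^sup>2"
    by (simp add: cmod_diff_square)
  finally show ?thesis .
qed

text \<open>An exact formula for arbitrary trial coefficients \<open>c\<close>. Choosing the Fourier
  coefficients gives Bessel's inequality and the error of partial sums; for any other choice the
  last sum measures the loss, and Parseval discards it.\<close>

lemma Q_diff_trig:
  assumes f: "f \<in> square_integrable" and "finite A"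
  shows "Q (\<lambda>z. f z - (\<Sum>k\<in>A. c k * z powi k))
    = Q f - (\<Sum>k\<in>A. (cmod (fourier_coeff f k))\<^sup>2) + (\<Sum>k\<in>A. (cmod (fourier_coeff f k - c k))\<^sup>2)"
  using \<open>finite A\<close>
proof induction
  case (insert j A)
  define g where "g = (\<lambda>z. f z - (\<Sum>k\<in>A. c k * z powi k))"
  \<comment> \<open>Because \<open>j\<close> is not in \<open>A\<close>, subtracting the frequencies
    in \<open>A\<close> leaves the coefficient at \<open>j\<close> unchanged, so no mixed terms
    arise.\<close>
  have g: "g \<in> square_integrable" and coeff: "fourier_coeff g j = fourier_coeff f j"
    using insert.hyps
    by (simp_all add: g_def square_integrable_diff f square_integrable_trig fourier_coeff_diff fourier_coeff_trig)
  have "Q (\<lambda>z. f z - (\<Sum>k\<in>insert j A. c k * z powi k)) = Q (\<lambda>z. g z - c j * z powi j)"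
    using insert.hyps by (simp add: g_def algebra_simps)
  also have "\<dots> = Q g - (cmod (fourier_coeff f j))\<^sup>2 + (cmod (fourier_coeff f j - c j))\<^sup>2"
    using Q_diff_monomial[OF g] coeff by simp
  finally show ?case
    using insert by (simp add: g_def)
qed simp

lemma Bessel_inequality:
  assumes "f \<in> square_integrable" "finite A"
  shows "(\<Sum>k\<in>A. (cmod (fourier_coeff f k))\<^sup>2) \<le> Q f"
  using Q_diff_trig[OF assms, of "fourier_coeff f"] Q_nonneg[of "\<lambda>z. f z - (\<Sum>k\<in>A. fourier_coeff f k * z powi k)"]
  by simp

subsection \<open>Density of trigonometric polynomials and Parseval\<close>

text \<open>Trigonometric polynomials written over a common power of z, so that sums and products
  reduce to operations on ordinary polynomials. This is the link from the real polynomials of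
  Stone-Weierstrass to Fourier sums.\<close>

definition laurent_on_circle :: "(complex \<Rightarrow> complex) \<Rightarrow> bool" where
  "laurent_on_circle f \<longleftrightarrow> (\<exists>n P. \<forall>z. cmod z = 1 \<longrightarrow> f z = z powi (- int n) * poly P z)"

lemma laurent_on_circleI:
  "(\<And>z. cmod z = 1 \<Longrightarrow> f z = z powi (- int n) * poly P z) \<Longrightarrow> laurent_on_circle f"
  unfolding laurent_on_circle_def by blast

lemma laurent_on_circle_const: "laurent_on_circle (\<lambda>z. c)"
  by (rule laurent_on_circleI[of _ 0 "[:c:]"]) simp

lemma laurent_on_circle_Re: "laurent_on_circle (\<lambda>z. complex_of_real (Re z))"
proof (rule laurent_on_circleI[of _ 1 "[:1/2, 0, 1/2:]"])
  fix z :: complex assume z: "cmod z = 1"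
  then have "z \<noteq> 0" by auto
  have "complex_of_real (Re z) = (z + cnj z) / 2"
    by (simp add: complex_eq_iff)
  also have "\<dots> = (z + inverse z) / 2"
    by (simp add: cnj_circle z)
  also have "\<dots> = z powi (- int 1) * poly [:1/2, 0, 1/2:] z"
    using \<open>z \<noteq> 0\<close> by (simp add: field_simps)
  finally show "complex_of_real (Re z) = z powi (- int 1) * poly [:1/2, 0, 1/2:] z" .
qed

lemma laurent_on_circle_Im: "laurent_on_circle (\<lambda>z. complex_of_real (Im z))"
proof (rule laurent_on_circleI[of _ 1 "[:\<i>/2, 0, -\<i>/2:]"])
  fix z :: complex assume z: "cmod z = 1"
  then have "z \<noteq> 0" by auto
  have "complex_of_real (Im z) = - \<i> / 2 * (z - cnj z)"
    by (simp add: complex_eq_iff)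
  also have "\<dots> = - \<i> / 2 * (z - inverse z)"
    by (simp add: cnj_circle z)
  also have "\<dots> = z powi (- int 1) * poly [:\<i>/2, 0, -\<i>/2:] z"
    using \<open>z \<noteq> 0\<close> by (simp add: field_simps)
  finally show "complex_of_real (Im z) = z powi (- int 1) * poly [:\<i>/2, 0, -\<i>/2:] z" .
qed

lemma laurent_on_circle_add:
  assumes "laurent_on_circle f" "laurent_on_circle g"
  shows "laurent_on_circle (\<lambda>z. f z + g z)"
proof -
  obtain n P m R where f: "\<And>z. cmod z = 1 \<Longrightarrow> f z = z powi (- int n) * poly P z"
    and g: "\<And>z. cmod z = 1 \<Longrightarrow> g z = z powi (- int m) * poly R z"
    using assms unfolding laurent_on_circle_def by blast
  show ?thesis
  proof (rule laurent_on_circleI[of _ "n + m" "monom 1 m * P + monom 1 n * R"])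
    fix z :: complex assume z: "cmod z = 1"
    then have "z \<noteq> 0" by auto
    moreover have "z powi (- int (n + m)) = inverse (z ^ n) * inverse (z ^ m)"
      by (simp only: power_int_minus power_int_of_nat power_add inverse_mult_distrib)
    ultimately show "f z + g z = z powi (- int (n + m)) * poly (monom 1 m * P + monom 1 n * R) z"
      by (simp add: f g z poly_monom power_int_minus field_simps)
  qed
qed

lemma laurent_on_circle_mult:
  assumes "laurent_on_circle f" "laurent_on_circle g"
  shows "laurent_on_circle (\<lambda>z. f z * g z)"
proof -
  obtain n P m R where f: "\<And>z. cmod z = 1 \<Longrightarrow> f z = z powi (- int n) * poly P z"
    and g: "\<And>z. cmod z = 1 \<Longrightarrow> g z = z powi (- int m) * poly R z"
    using assms unfolding laurent_on_circle_def by blast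
  show ?thesis
  proof (rule laurent_on_circleI[of _ "n + m" "P * R"])
    fix z :: complex assume z: "cmod z = 1"
    then have "z \<noteq> 0" by auto
    moreover have "z powi (- int (n + m)) = inverse (z ^ n) * inverse (z ^ m)"
      by (simp only: power_int_minus power_int_of_nat power_add inverse_mult_distrib)
    ultimately show "f z * g z = z powi (- int (n + m)) * poly (P * R) z"
      by (simp add: f g z power_int_minus field_simps)
  qed
qed

text \<open>Real polynomial functions are generated by constants and linear forms, and a linear form
  on the plane is a real combination of \<open>Re\<close> and \<open>Im\<close>, which on the circle
  are combinations of z and its inverse.\<close>

lemma laurent_on_circle_real_polynomial_function:
  assumes "real_polynomial_function p"
  shows "laurent_on_circle (\<lambda>z. complex_of_real (p z))"
  using assms
proof induction
  case (linear f)
  then interpret bounded_linear f .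
  have eq: "f z = Re z * f 1 + Im z * f \<i>" for z
  proof -
    have "f z = f (Re z *\<^sub>R 1 + Im z *\<^sub>R \<i>)"
      by (rule arg_cong[of _ _ f]) (simp add: complex_eq_iff)
    then show ?thesis by (simp only: add scaleR real_scaleR_def)
  qed
  have "laurent_on_circle (\<lambda>z. complex_of_real (Re z) * f 1 + complex_of_real (Im z) * f \<i>)"
    by (intro laurent_on_circle_add laurent_on_circle_mult laurent_on_circle_Re
        laurent_on_circle_Im laurent_on_circle_const)
  then show ?case by (subst eq) simp
qed (simp_all add: laurent_on_circle_const laurent_on_circle_add laurent_on_circle_mult)

lemma laurent_on_circle_imp_trig:
  assumes "laurent_on_circle f"
  obtains A c where "finite A" "\<And>z. cmod z = 1 \<Longrightarrow> f z = (\<Sum>k\<in>A. c k * z powi k)"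
proof -
  obtain n P where f: "\<And>z. cmod z = 1 \<Longrightarrow> f z = z powi (- int n) * poly P z"
    using assms unfolding laurent_on_circle_def by blast
  \<comment> \<open>The exponent that the \<open>i\<close>-th monomial of \<open>P\<close> gets
    after division by z^n; injectivity allows the coefficients to be indexed by exponents through
    \<open>inv h\<close>.\<close>
  define h where "h = (\<lambda>i::nat. int i - int n)"
  have "inj h" by (simp add: h_def inj_def)
  show ?thesis
  proof
    show "finite (h ` {..degree P})" by simp
    fix z :: complex assume z: "cmod z = 1"
    then have "z \<noteq> 0" by auto
    have "f z = (\<Sum>i\<le>degree P. coeff P i * z powi (h i))"
      using \<open>z \<noteq> 0\<close>
      by (simp add: f z poly_altdef sum_distrib_left h_def power_int_diff power_int_minus field_simps)
    also have "\<dots> = (\<Sum>k\<in>h ` {..degree P}. coeff P (inv h k) * z powi k)"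
      using \<open>inj h\<close> by (subst sum.reindex) (auto intro: inj_on_subset)
    finally show "f z = (\<Sum>k\<in>h ` {..degree P}. coeff P (inv h k) * z powi k)" .
  qed
qed

text \<open>The L^2 closure of the trigonometric polynomials. The coefficients are arbitrary, since
  comparing them with Fourier coefficients is the task of \<open>Q_diff_trig\<close>.\<close>

definition trig_approximable :: "(complex \<Rightarrow> complex) \<Rightarrow> bool" where
  "trig_approximable f \<longleftrightarrow> f \<in> square_integrable \<and>
    (\<forall>e>0. \<exists>A c. finite A \<and> Q (\<lambda>z. f z - (\<Sum>k\<in>A. c k * z powi k)) < e)"

lemma trig_approximable_imp_square_integrable:
  "trig_approximable f \<Longrightarrow> f \<in> square_integrable"
  by (simp add: trig_approximable_def)

text \<open>A closure is closed. Each enlargement of the class of approximable functions goes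
  through this lemma, from continuous functions up to all of L^2.\<close>

lemma trig_approximable_limit:
  assumes f: "f \<in> square_integrable"
    and lim: "\<And>e. e > 0 \<Longrightarrow> \<exists>g. trig_approximable g \<and> Q (\<lambda>z. f z - g z) < e"
  shows "trig_approximable f"
  unfolding trig_approximable_def
proof (intro conjI f allI impI)
  fix e :: real assume "e > 0"
  then obtain g where g: "trig_approximable g" and fg: "Q (\<lambda>z. f z - g z) < e / 4"
    using lim[of "e / 4"] by auto
  obtain A c where A: "finite A" and gp: "Q (\<lambda>z. g z - (\<Sum>k\<in>A. c k * z powi k)) < e / 4"
    using g \<open>e > 0\<close> unfolding trig_approximable_def by (meson divide_pos_pos zero_less_numeral)
  have "Q (\<lambda>z. (f z - g z) + (g z - (\<Sum>k\<in>A. c k * z powi k)))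
      \<le> 2 * Q (\<lambda>z. f z - g z) + 2 * Q (\<lambda>z. g z - (\<Sum>k\<in>A. c k * z powi k))"
    using g f by (intro Q_add_le square_integrable_diff square_integrable_trig)
      (auto simp: trig_approximable_def)
  then have "Q (\<lambda>z. f z - (\<Sum>k\<in>A. c k * z powi k)) < e"
    using fg gp by simp
  then show "\<exists>A c. finite A \<and> Q (\<lambda>z. f z - (\<Sum>k\<in>A. c k * z powi k)) < e"
    using A by blast
qed

lemma trig_approximable_cmult:
  assumes "trig_approximable f"
  shows "trig_approximable (\<lambda>z. a * f z)"
  unfolding trig_approximable_def
proof (intro conjI allI impI)
  show "(\<lambda>z. a * f z) \<in> square_integrable"
    using assms by (simp add: trig_approximable_def square_integrable_cmult)
  fix e :: real assume "e > 0"
  \<comment> \<open>The summand 1 keeps the denominator positive when \<open>a = 0\<close>.\<close>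
  then have "e / (1 + (cmod a)\<^sup>2) > 0"
    by (simp add: add_pos_nonneg)
  then obtain A c where A: "finite A"
    and fp: "Q (\<lambda>z. f z - (\<Sum>k\<in>A. c k * z powi k)) < e / (1 + (cmod a)\<^sup>2)"
    using assms unfolding trig_approximable_def by meson
  have "Q (\<lambda>z. a * f z - (\<Sum>k\<in>A. (a * c k) * z powi k))
      = (cmod a)\<^sup>2 * Q (\<lambda>z. f z - (\<Sum>k\<in>A. c k * z powi k))"
    by (simp add: sum_distrib_left mult.assoc right_diff_distrib flip: Q_cmult)
  also have "\<dots> \<le> (1 + (cmod a)\<^sup>2) * Q (\<lambda>z. f z - (\<Sum>k\<in>A. c k * z powi k))"
    by (intro mult_right_mono Q_nonneg) simp
  also have "\<dots> < e"
    using fp by (simp add: pos_less_divide_eq add_pos_nonneg mult.commute)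
  finally have "Q (\<lambda>z. a * f z - (\<Sum>k\<in>A. (a * c k) * z powi k)) < e" .
  with A show "\<exists>A c. finite A \<and> Q (\<lambda>z. a * f z - (\<Sum>k\<in>A. c k * z powi k)) < e"
    by (intro exI[of _ A] exI[of _ "\<lambda>k. a * c k"] conjI)
qed

lemma trig_approximable_add:
  assumes f: "trig_approximable f" and g: "trig_approximable g"
  shows "trig_approximable (\<lambda>z. f z + g z)"
  unfolding trig_approximable_def
proof (intro conjI allI impI)
  note si = trig_approximable_imp_square_integrable[OF f] trig_approximable_imp_square_integrable[OF g]
  show "(\<lambda>z. f z + g z) \<in> square_integrable"
    using si by (rule square_integrable_add)
  fix e :: real assume "e > 0"
  obtain A c where A: "finite A" and fp: "Q (\<lambda>z. f z - (\<Sum>k\<in>A. c k * z powi k)) < e / 4"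
    using f \<open>e > 0\<close> unfolding trig_approximable_def by (meson divide_pos_pos zero_less_numeral)
  obtain B d where B: "finite B" and gp: "Q (\<lambda>z. g z - (\<Sum>k\<in>B. d k * z powi k)) < e / 4"
    using g \<open>e > 0\<close> unfolding trig_approximable_def by (meson divide_pos_pos zero_less_numeral)
  define c' where "c' = (\<lambda>k. (if k \<in> A then c k else 0) + (if k \<in> B then d k else 0))"
  have sum_eq: "(\<Sum>k\<in>A \<union> B. c' k * z powi k) = (\<Sum>k\<in>A. c k * z powi k) + (\<Sum>k\<in>B. d k * z powi k)" for z
  proof -
    have "(\<Sum>k\<in>A \<union> B. c' k * z powi k)
       = (\<Sum>k\<in>A \<union> B. if k \<in> A then c k * z powi k else 0) + (\<Sum>k\<in>A \<union> B. if k \<in> B then d k * z powi k else 0)"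
      unfolding c'_def sum.distrib[symmetric] by (intro sum.cong) (auto simp: algebra_simps)
    also have "(\<Sum>k\<in>A \<union> B. if k \<in> A then c k * z powi k else 0) = (\<Sum>k\<in>A. c k * z powi k)"
      using A B by (simp add: sum.If_cases Int_absorb1)
    also have "(\<Sum>k\<in>A \<union> B. if k \<in> B then d k * z powi k else 0) = (\<Sum>k\<in>B. d k * z powi k)"
      using A B by (simp add: sum.If_cases Int_absorb1)
    finally show ?thesis .
  qed
  have "Q (\<lambda>z. (f z - (\<Sum>k\<in>A. c k * z powi k)) + (g z - (\<Sum>k\<in>B. d k * z powi k)))
      \<le> 2 * Q (\<lambda>z. f z - (\<Sum>k\<in>A. c k * z powi k)) + 2 * Q (\<lambda>z. g z - (\<Sum>k\<in>B. d k * z powi k))"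
    using si by (intro Q_add_le square_integrable_diff square_integrable_trig)
  then have "Q (\<lambda>z. f z + g z - (\<Sum>k\<in>A \<union> B. c' k * z powi k)) < e"
    using fp gp by (simp add: sum_eq algebra_simps)
  with A B show "\<exists>A c. finite A \<and> Q (\<lambda>z. f z + g z - (\<Sum>k\<in>A. c k * z powi k)) < e"
    by (intro exI[of _ "A \<union> B"] exI[of _ c'] conjI) auto
qed

lemma trig_approximable_sum:
  "finite I \<Longrightarrow> (\<And>i. i \<in> I \<Longrightarrow> trig_approximable (f i)) \<Longrightarrow> trig_approximable (\<lambda>z. \<Sum>i\<in>I. f i z)"
proof (induction I rule: finite_induct)
  case empty
  show ?case
    unfolding trig_approximable_def
    by (auto simp: square_integrable_const Q_def intro!: exI[of _ "{}"])
qed (simp add: trig_approximable_add)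

lemma Q_le_bound:
  assumes "f \<in> square_integrable" "\<And>z. cmod z = 1 \<Longrightarrow> (cmod (f z))\<^sup>2 \<le> B"
  shows "Q f \<le> B"
proof -
  have "Q f \<le> (LINT z|circle. B)"
    unfolding Q_def using assms by (intro integral_mono) (auto simp: square_integrable_def)
  then show ?thesis by simp
qed

lemma trig_approximable_continuous:
  fixes g :: "complex \<Rightarrow> real"
  assumes g: "continuous_on (sphere 0 1) g"
  shows "trig_approximable (\<lambda>z. complex_of_real (g z))"
proof -
  have gm: "(\<lambda>z. complex_of_real (g z)) \<in> borel_measurable circle"
    using g by (intro continuous_on_circle_measurable continuous_intros)
  have "compact (g ` sphere 0 1)"
    using g by (intro compact_continuous_image compact_sphere)
  then obtain B where "\<And>z. cmod z = 1 \<Longrightarrow> \<bar>g z\<bar> \<le> B"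
    by (force dest!: compact_imp_bounded simp: bounded_iff)
  then have si: "(\<lambda>z. complex_of_real (g z)) \<in> square_integrable"
    by (intro square_integrable_bounded[OF gm, of B]) auto
  show ?thesis
    unfolding trig_approximable_def
  proof (intro conjI si allI impI)
    fix e :: real assume "e > 0"
    \<comment> \<open>As the circle has total mass 1, a uniform error below
      \<open>sqrt (e / 2)\<close> makes \<open>Q\<close> of the difference at most
      \<open>e / 2\<close>, hence strictly below \<open>e\<close>.\<close>
    then obtain p where p: "real_polynomial_function p"
      and pg: "\<And>z. z \<in> sphere 0 1 \<Longrightarrow> \<bar>g z - p z\<bar> < sqrt (e / 2)"
      using Stone_Weierstrass_real_polynomial_function[OF compact_sphere g, of "sqrt (e / 2)"] by auto
    obtain A c where A: "finite A" and pc: "\<And>z. cmod z = 1 \<Longrightarrow> complex_of_real (p z) = (\<Sum>k\<in>A. c k * z powi k)"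
      using laurent_on_circle_imp_trig[OF laurent_on_circle_real_polynomial_function[OF p]] by metis
    have "Q (\<lambda>z. complex_of_real (g z) - (\<Sum>k\<in>A. c k * z powi k)) \<le> e / 2"
    proof (rule Q_le_bound)
      fix z :: complex assume z: "cmod z = 1"
      have "(cmod (complex_of_real (g z) - (\<Sum>k\<in>A. c k * z powi k)))\<^sup>2 = \<bar>g z - p z\<bar>\<^sup>2"
        using pc[OF z] by (metis norm_of_real of_real_diff)
      also have "\<dots> \<le> (sqrt (e / 2))\<^sup>2"
        using pg[of z] z by (intro power_mono) auto
      finally show "(cmod (complex_of_real (g z) - (\<Sum>k\<in>A. c k * z powi k)))\<^sup>2 \<le> e / 2"
        using \<open>e > 0\<close> by simp
    qed (intro square_integrable_diff si square_integrable_trig)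
    then show "\<exists>A c. finite A \<and> Q (\<lambda>z. complex_of_real (g z) - (\<Sum>k\<in>A. c k * z powi k)) < e"
      using A \<open>e > 0\<close> by (intro exI[of _ A] exI[of _ c]) auto
  qed
qed

text \<open>By regularity, \<open>B\<close> lies between a compact and an open set whose difference is small; a Urysohn
  function for this pair approximates the indicator.\<close>

lemma trig_approximable_indicator:
  assumes "B \<in> sets circle"
  shows "trig_approximable (\<lambda>z. complex_of_real (indicator B z))"
proof (rule trig_approximable_limit)
  note [measurable] = assms
  have id_meas [measurable]: "(\<lambda>z. z) \<in> measurable circle borel"
    by (intro continuous_on_circle_measurable continuous_intros)
  show si: "(\<lambda>z. complex_of_real (indicator B z)) \<in> square_integrable"
    by (rule square_integrable_bounded[of _ 1]) (auto split: split_indicator)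
  have B: "B \<in> sets borel" "B \<subseteq> sphere 0 1"
    using assms by (auto simp: sets_circle sets_restrict_space)
  \<comment> \<open>The regularity theorems speak of Borel measures on the whole plane, so the
    measure is pushed forward from the circle.\<close>
  define N where "N = distr circle borel (\<lambda>z. z)"
  interpret N: finite_measure N
    unfolding N_def by (rule circle.finite_measure_distr) simp
  have [simp]: "sets N = sets borel" by (simp add: N_def)
  fix e :: real assume "e > 0"
  have ne: "{K. K \<subseteq> B \<and> compact K} \<noteq> {}"
    using compact_empty by blast
  have e2: "e / 2 > 0" using \<open>e > 0\<close> by simp
  have N_fin: "emeasure N A \<noteq> \<infinity>" for A
    by simp
  note reg = inner_regular[OF \<open>sets N = sets borel\<close> N_fin B(1)]
    outer_regular[OF \<open>sets N = sets borel\<close> N_fin B(1)]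
  have "\<exists>K\<in>{K. K \<subseteq> B \<and> compact K}. emeasure N B < emeasure N K + ennreal (e / 2)"
    by (rule SUP_approx_ennreal[OF e2 ne reg(1) N_fin])
  then obtain K where K: "K \<subseteq> B" "compact K" and NK: "emeasure N B < emeasure N K + ennreal (e / 2)"
    by auto
  have "\<exists>U\<in>{U. B \<subseteq> U \<and> open U}. emeasure N U < emeasure N B + ennreal (e / 2)"
    by (rule INF_approx_ennreal[OF e2 reg(2) N_fin])
  then obtain U where U: "B \<subseteq> U" "open U" and NU: "emeasure N U < emeasure N B + ennreal (e / 2)"
    by auto
  have [measurable]: "K \<in> sets borel" "U \<in> sets borel"
    using K U by (auto intro: borel_compact)
  have KB: "measure N B < measure N K + e / 2" and UB: "measure N U < measure N B + e / 2"
    using NK NU \<open>e > 0\<close>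
    by (simp_all add: N.emeasure_eq_measure ennreal_less_iff flip: ennreal_plus)
  have "measure N (U - K) = measure N U - measure N K"
    using K U by (intro N.finite_measure_Diff) auto
  then have "measure N (U - K) < e" using KB UB by simp
  moreover have "measure N (U - K) = measure circle ((U - K) \<inter> sphere 0 1)"
    unfolding N_def by (subst measure_distr) (auto)
  ultimately have small: "measure circle ((U - K) \<inter> sphere 0 1) < e" by simp
  have UKs: "(U - K) \<inter> sphere 0 1 \<in> sets circle"
    by (auto simp: sets_circle sets_restrict_space_iff)
  obtain g :: "complex \<Rightarrow> real" where g: "continuous_on UNIV g" "\<And>z. g z \<in> closed_segment 1 0"
    "\<And>z. z \<in> K \<Longrightarrow> g z = 1" "\<And>z. z \<in> - U \<Longrightarrow> g z = 0"
    using Urysohn[of K "- U" "1::real" 0] K U compact_imp_closed[OF K(2)] closed_Compl[OF U(2)]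
    by (metis Compl_iff disjoint_iff subsetD)
  have g01: "0 \<le> g z" "g z \<le> 1" for z
    using g(2)[of z] by (auto simp: closed_segment_eq_real_ivl)
  have ga: "trig_approximable (\<lambda>z. complex_of_real (g z))"
    using g(1) by (intro trig_approximable_continuous) (auto intro: continuous_on_subset)
  have "Q (\<lambda>z. complex_of_real (indicator B z) - complex_of_real (g z))
      \<le> (LINT z|circle. indicator ((U - K) \<inter> sphere 0 1) z)"
    unfolding Q_def
  proof (rule integral_mono)
    show "integrable circle (\<lambda>z. (cmod (complex_of_real (indicator B z) - complex_of_real (g z)))\<^sup>2)"
      using square_integrable_diff[OF si trig_approximable_imp_square_integrable[OF ga]]
      by (simp add: square_integrable_def)
    show "integrable circle (indicator ((U - K) \<inter> sphere 0 1) :: complex \<Rightarrow> real)"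
      using UKs by (simp add: integrable_indicator_iff circle.emeasure_eq_measure)
    fix z assume z: "z \<in> space circle"
    have "\<bar>indicator B z - g z\<bar>\<^sup>2 \<le> (indicator ((U - K) \<inter> sphere 0 1) z :: real)"
    proof (cases "z \<in> U - K")
      case True
      have "\<bar>indicator B z - g z\<bar>\<^sup>2 \<le> 1"
        using g01[of z] by (intro power_le_one) (auto split: split_indicator)
      with True z show ?thesis by simp
    next
      case False
      then have "indicator B z - g z = 0"
        using K U g(3,4)[of z] by (auto split: split_indicator)
      then show ?thesis by simp
    qed
    then show "(cmod (complex_of_real (indicator B z) - complex_of_real (g z)))\<^sup>2
        \<le> indicator ((U - K) \<inter> sphere 0 1) z"
      by (metis norm_of_real of_real_diff)
  qed
  also have "\<dots> < e"
    using small UKs by simp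
  finally show "\<exists>g. trig_approximable g \<and> Q (\<lambda>z. complex_of_real (indicator B z) - g z) < e"
    using ga by blast
qed

lemma trig_approximable_simple_function:
  assumes "simple_function circle f"
  shows "trig_approximable f"
proof -
  define h where "h = (\<lambda>z. \<Sum>y\<in>f ` space circle. y * complex_of_real (indicator (f -` {y} \<inter> space circle) z))"
  have h: "trig_approximable h"
    unfolding h_def using simple_functionD[OF assms]
    by (intro trig_approximable_sum trig_approximable_cmult trig_approximable_indicator) auto
  have eq: "f z = h z" if "cmod z = 1" for z
  proof -
    have "f z = (\<Sum>y\<in>f ` space circle. indicator (f -` {y} \<inter> space circle) z *\<^sub>R y)"
      using assms that by (intro simple_function_indicator_representation_banach) auto
    also have "\<dots> = h z"
      unfolding h_def by (intro sum.cong) (simp_all add: scaleR_conv_of_real)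
    finally show ?thesis .
  qed
  have "integrable circle (\<lambda>z. (cmod (f z))\<^sup>2) \<longleftrightarrow> integrable circle (\<lambda>z. (cmod (h z))\<^sup>2)"
    by (rule Bochner_Integration.integrable_cong) (simp_all add: eq)
  then have "f \<in> square_integrable"
    using h borel_measurable_simple_function[OF assms]
    by (simp add: trig_approximable_def square_integrable_def)
  \<comment> \<open>\<open>f\<close> and \<open>h\<close> agree on the circle but possibly not
    elsewhere, so approximability is transferred through the limit lemma at distance 0.\<close>
  then show ?thesis
  proof (rule trig_approximable_limit)
    fix e :: real assume "e > 0"
    have "Q (\<lambda>z. f z - h z) = 0"
      unfolding Q_def by (subst Bochner_Integration.integral_cong[OF refl, of _ _ "\<lambda>_. 0"]) (auto simp: eq)
    with h \<open>e > 0\<close> show "\<exists>g. trig_approximable g \<and> Q (\<lambda>z. f z - g z) < e"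
      by (intro exI[of _ h]) simp
  qed
qed

lemma square_integrable_trig_approximable:
  assumes f: "f \<in> square_integrable"
  shows "trig_approximable f"
proof (rule trig_approximable_limit[OF f])
  note fm [measurable] = square_integrableD(1)[OF f]
  obtain s where s: "\<And>i. simple_function circle (s i)"
    "\<And>z. z \<in> space circle \<Longrightarrow> (\<lambda>i. s i z) \<longlonglongrightarrow> f z"
    "\<And>i z. z \<in> space circle \<Longrightarrow> dist (s i z) 0 \<le> 2 * dist (f z) 0"
    using borel_measurable_implies_sequence_metric[OF fm, of 0] by metis
  have [measurable]: "s i \<in> borel_measurable circle" for i
    using s(1) by (rule borel_measurable_simple_function)
  have "(\<lambda>i. Q (\<lambda>z. f z - s i z)) \<longlonglongrightarrow> (LINT z|circle. 0)"
    unfolding Q_def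
  proof (rule integral_dominated_convergence)
    \<comment> \<open>The approximants satisfy |s i| \<le> 2 |f|, so the squared difference is at
      most (1 + 2)^2 |f|^2.\<close>
    show "integrable circle (\<lambda>z. 9 * (cmod (f z))\<^sup>2)"
      using square_integrableD(2)[OF f] by simp
    show "AE z in circle. (\<lambda>i. (cmod (f z - s i z))\<^sup>2) \<longlonglongrightarrow> 0"
    proof (rule AE_I2)
      fix z assume "z \<in> space circle"
      from s(2)[OF this] have "(\<lambda>i. (cmod (f z - s i z))\<^sup>2) \<longlonglongrightarrow> (cmod (f z - f z))\<^sup>2"
        by (intro tendsto_intros)
      then show "(\<lambda>i. (cmod (f z - s i z))\<^sup>2) \<longlonglongrightarrow> 0" by simp
    qed
    fix i
    show "AE z in circle. norm ((cmod (f z - s i z))\<^sup>2) \<le> 9 * (cmod (f z))\<^sup>2"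
    proof (rule AE_I2)
      fix z assume "z \<in> space circle"
      then have "cmod (f z - s i z) \<le> 3 * cmod (f z)"
        using s(3)[of z i] norm_triangle_ineq4[of "f z" "s i z"] by (simp add: dist_norm)
      then have "(cmod (f z - s i z))\<^sup>2 \<le> (3 * cmod (f z))\<^sup>2"
        by (intro power_mono) auto
      then show "norm ((cmod (f z - s i z))\<^sup>2) \<le> 9 * (cmod (f z))\<^sup>2"
        by (simp add: power_mult_distrib)
    qed
  qed measurable
  then have lim: "(\<lambda>i. Q (\<lambda>z. f z - s i z)) \<longlonglongrightarrow> 0" by simp
  fix e :: real assume "e > 0"
  then obtain i where "Q (\<lambda>z. f z - s i z) < e"
    using order_tendstoD(2)[OF lim] by (auto simp: eventually_sequentially)
  then show "\<exists>g. trig_approximable g \<and> Q (\<lambda>z. f z - g z) < e"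
    using trig_approximable_simple_function[OF s(1)] by blast
qed

text \<open>Bessel bounds all finite sums by \<open>Q f\<close>. Conversely, a trigonometric
  polynomial within \<open>e\<close> of \<open>f\<close>, whatever its coefficients, forces the
  finite sum over its frequencies to exceed \<open>Q f - e\<close>, by \<open>Q_diff_trig\<close>.
  For nonnegative terms the unordered sum is the supremum of the finite ones.\<close>

theorem Parseval:
  assumes f: "f \<in> square_integrable"
  shows "((\<lambda>k. (cmod (fourier_coeff f k))\<^sup>2) has_sum Q f) UNIV"
proof -
  let ?b = "\<lambda>k. (cmod (fourier_coeff f k))\<^sup>2"
  have bdd: "bdd_above (sum ?b ` {F. finite F \<and> F \<subseteq> UNIV})"
    using Bessel_inequality[OF f] by (intro bdd_aboveI[of _ "Q f"]) auto
  have "(SUP F\<in>{F. finite F \<and> F \<subseteq> UNIV}. sum ?b F) = Q f"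
  proof (rule antisym)
    show "(SUP F\<in>{F. finite F \<and> F \<subseteq> UNIV}. sum ?b F) \<le> Q f"
      using Bessel_inequality[OF f] by (intro cSUP_least) auto
    show "Q f \<le> (SUP F\<in>{F. finite F \<and> F \<subseteq> UNIV}. sum ?b F)"
    proof (rule field_le_epsilon)
      fix e :: real assume "e > 0"
      then obtain A c where A: "finite A" and "Q (\<lambda>z. f z - (\<Sum>k\<in>A. c k * z powi k)) < e"
        using square_integrable_trig_approximable[OF f] unfolding trig_approximable_def by blast
      moreover have "0 \<le> (\<Sum>k\<in>A. (cmod (fourier_coeff f k - c k))\<^sup>2)"
        by (intro sum_nonneg) auto
      ultimately have "Q f \<le> sum ?b A + e"
        using Q_diff_trig[OF f A, of c] by simp
      also have "sum ?b A \<le> (SUP F\<in>{F. finite F \<and> F \<subseteq> UNIV}. sum ?b F)"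
        using A bdd by (intro cSUP_upper) auto
      finally show "Q f \<le> (SUP F\<in>{F. finite F \<and> F \<subseteq> UNIV}. sum ?b F) + e" by simp
    qed
  qed
  moreover have "(?b has_sum (SUP F\<in>{F. finite F \<and> F \<subseteq> UNIV}. sum ?b F)) UNIV"
    using bdd by (intro nonneg_bdd_above_has_sum) (auto simp: conj_commute)
  ultimately show ?thesis by simp
qed

subsection \<open>Squares of convolutions\<close>

text \<open>Lagrange's identity against the constant vector 1: the Cauchy-Schwarz defect is a sum of
  squares, which delivers the inequality and its equality case together.\<close>

lemma sum_cmod_diff_square:
  "(\<Sum>i\<in>A. \<Sum>j\<in>A. (cmod (x i - x j))\<^sup>2)
    = 2 * (real (card A) * (\<Sum>i\<in>A. (cmod (x i))\<^sup>2) - (cmod (\<Sum>i\<in>A. x i))\<^sup>2)"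
proof -
  have "(\<Sum>i\<in>A. \<Sum>j\<in>A. (cmod (x i - x j))\<^sup>2)
      = (\<Sum>i\<in>A. \<Sum>j\<in>A. (cmod (x i))\<^sup>2) - 2 * (\<Sum>i\<in>A. \<Sum>j\<in>A. Re (cnj (x j) * x i))
        + (\<Sum>i\<in>A. \<Sum>j\<in>A. (cmod (x j))\<^sup>2)"
    unfolding cmod_diff_square by (simp only: sum.distrib sum_subtractf sum_distrib_left)
  also have "(\<Sum>i\<in>A. \<Sum>j\<in>A. Re (cnj (x j) * x i)) = Re ((\<Sum>i\<in>A. x i) * cnj (\<Sum>j\<in>A. x j))"
    unfolding cnj_sum sum_product Re_sum by (simp only: mult.commute)
  also have "\<dots> = (cmod (\<Sum>i\<in>A. x i))\<^sup>2"
    by (metis Re_complex_of_real complex_norm_square)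
  finally show ?thesis
    by (simp add: sum_distrib_left)
qed

lemma cmod_sum_square_le:
  "(cmod (\<Sum>i\<in>A. x i))\<^sup>2 \<le> real (card A) * (\<Sum>i\<in>A. (cmod (x i))\<^sup>2)"
proof -
  have "0 \<le> (\<Sum>i\<in>A. \<Sum>j\<in>A. (cmod (x i - x j))\<^sup>2)"
    by (intro sum_nonneg) auto
  then show ?thesis by (simp add: sum_cmod_diff_square)
qed

lemma cmod_sum_square_eq_iff:
  assumes "finite A"
  shows "(cmod (\<Sum>i\<in>A. x i))\<^sup>2 = real (card A) * (\<Sum>i\<in>A. (cmod (x i))\<^sup>2)
    \<longleftrightarrow> (\<forall>i\<in>A. \<forall>j\<in>A. x i = x j)"
proof -
  have "(cmod (\<Sum>i\<in>A. x i))\<^sup>2 = real (card A) * (\<Sum>i\<in>A. (cmod (x i))\<^sup>2)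
      \<longleftrightarrow> (\<Sum>i\<in>A. \<Sum>j\<in>A. (cmod (x i - x j))\<^sup>2) = 0"
    by (auto simp: sum_cmod_diff_square)
  also have "\<dots> \<longleftrightarrow> (\<forall>i\<in>A. \<forall>j\<in>A. x i = x j)"
    using assms by (simp add: sum_nonneg_eq_0_iff sum_nonneg)
  finally show ?thesis .
qed

text \<open>On the n-th diagonal n + 1 = 1 + j + (n - j), and each of the three summands gives a
  Cauchy product of absolutely convergent series.\<close>

lemma weighted_convolution_sums:
  fixes b :: "nat \<Rightarrow> real"
  assumes nonneg: "\<And>k. b k \<ge> 0" and b: "summable b" and kb: "summable (\<lambda>k. real k * b k)"
  shows "(\<lambda>n. real (n + 1) * (\<Sum>j\<le>n. b j * b (n - j)))
    sums (suminf b * (suminf b + 2 * (\<Sum>k. real k * b k)))"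
proof -
  have nb: "summable (\<lambda>k. norm (b k))" and nkb: "summable (\<lambda>k. norm (real k * b k))"
    using b kb nonneg by simp_all
  have "(\<lambda>n. (\<Sum>j\<le>n. b j * b (n - j)) + (\<Sum>j\<le>n. (real j * b j) * b (n - j))
          + (\<Sum>j\<le>n. b j * (real (n - j) * b (n - j))))
      sums (suminf b * suminf b + (\<Sum>k. real k * b k) * suminf b + suminf b * (\<Sum>k. real k * b k))"
    by (intro sums_add Cauchy_product_sums nb nkb)
  moreover have "(\<Sum>j\<le>n. b j * b (n - j)) + (\<Sum>j\<le>n. (real j * b j) * b (n - j))
          + (\<Sum>j\<le>n. b j * (real (n - j) * b (n - j))) = real (n + 1) * (\<Sum>j\<le>n. b j * b (n - j))" for n
    unfolding sum.distrib[symmetric] sum_distrib_left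
    by (intro sum.cong) (auto simp: of_nat_diff algebra_simps)
  ultimately show ?thesis
    by (simp add: algebra_simps)
qed

text \<open>Two instances suffice: \<open>a k * a k = a 0 * a (k + k)\<close> annihilates everything
  if \<open>a 0 = 0\<close>, and \<open>a 0 * a (Suc k) = a 1 * a k\<close> is otherwise a
  recurrence with ratio \<open>a 1 / a 0\<close>. The ratio 0 is allowed and, as
  \<open>0 ^ 0 = 1\<close>, describes a sequence supported at 0.\<close>

lemma geometric_iff_products_constant:
  fixes a :: "nat \<Rightarrow> complex"
  shows "(\<forall>n. \<forall>i\<le>n. \<forall>j\<le>n. a i * a (n - i) = a j * a (n - j))
    \<longleftrightarrow> (\<forall>k. a k = 0) \<or> (\<exists>p. a 0 \<noteq> 0 \<and> (\<forall>k. a k = a 0 * p ^ k))"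
    (is "?L \<longleftrightarrow> ?R")
proof
  assume L: ?L
  show ?R
  proof (cases "a 0 = 0")
    case True
    have "a k = 0" for k
      using L[rule_format, of k "k + k" 0] True by simp
    then show ?thesis by blast
  next
    case False
    define p where "p = a 1 / a 0"
    have step: "a (Suc k) = p * a k" for k
      using L[rule_format, of 0 "Suc k" 1] False by (simp add: p_def field_simps)
    have "a k = a 0 * p ^ k" for k
      by (induction k) (simp_all add: step)
    with False show ?thesis by blast
  qed
next
  assume R: ?R
  then show ?L
  proof
    assume "\<exists>p. a 0 \<noteq> 0 \<and> (\<forall>k. a k = a 0 * p ^ k)"
    then obtain p where p: "\<And>k. a k = a 0 * p ^ k" by blast
    have "a i * a (n - i) = a 0 * a 0 * p ^ n" if "i \<le> n" for i n
    proof -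
      have "a i * a (n - i) = a 0 * a 0 * (p ^ i * p ^ (n - i))"
        unfolding p[of i] p[of "n - i"] by simp
      also have "p ^ i * p ^ (n - i) = p ^ n"
        using that by (simp flip: power_add)
      finally show ?thesis .
    qed
    then show ?L by simp
  qed simp
qed

text \<open>Cauchy-Schwarz is used on each diagonal with its n + 1 terms. The defects
  \<open>?w n - ?c n\<close> are nonnegative and summable, so their sum vanishes only if each of
  them does.\<close>

lemma convolution_square_sum:
  fixes a :: "nat \<Rightarrow> complex"
  defines "b \<equiv> \<lambda>k. (cmod (a k))\<^sup>2"
  assumes b: "summable b" and kb: "summable (\<lambda>k. real k * b k)"
  shows "summable (\<lambda>n. (cmod (\<Sum>j\<le>n. a j * a (n - j)))\<^sup>2)" (is "summable ?c")
    and "(\<Sum>n. (cmod (\<Sum>j\<le>n. a j * a (n - j)))\<^sup>2) \<le> suminf b * (suminf b + 2 * (\<Sum>k. real k * b k))"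
    and "(\<Sum>n. (cmod (\<Sum>j\<le>n. a j * a (n - j)))\<^sup>2) = suminf b * (suminf b + 2 * (\<Sum>k. real k * b k))
      \<longleftrightarrow> (\<forall>k. a k = 0) \<or> (\<exists>p. a 0 \<noteq> 0 \<and> (\<forall>k. a k = a 0 * p ^ k))"
proof -
  let ?w = "\<lambda>n. real (n + 1) * (\<Sum>j\<le>n. b j * b (n - j))"
  let ?T = "suminf b * (suminf b + 2 * (\<Sum>k. real k * b k))"
  have w: "?w sums ?T"
    by (rule weighted_convolution_sums[OF _ b kb]) (simp add: b_def)
  have wn: "?w n = real (card {..n}) * (\<Sum>j\<in>{..n}. (cmod (a j * a (n - j)))\<^sup>2)" for n
    by (simp add: b_def norm_mult power_mult_distrib)
  have le: "?c n \<le> ?w n" for n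
    unfolding wn by (rule cmod_sum_square_le)
  show c: "summable ?c"
    by (rule summable_comparison_test'[OF sums_summable[OF w], of 0]) (use le in simp)
  have diff: "(\<lambda>n. ?w n - ?c n) sums (?T - suminf ?c)"
    by (intro sums_diff w summable_sums c)
  show "suminf ?c \<le> ?T"
    using suminf_le[OF le c sums_summable[OF w]] sums_unique[OF w] by simp
  have "suminf ?c = ?T \<longleftrightarrow> (\<Sum>n. ?w n - ?c n) = 0"
    using sums_unique[OF diff] by auto
  also have "\<dots> \<longleftrightarrow> (\<forall>n. ?w n - ?c n = 0)"
    using le by (intro suminf_eq_zero_iff sums_summable[OF diff]) (simp add: algebra_simps)
  also have "\<dots> \<longleftrightarrow> (\<forall>n. ?c n = ?w n)"
    unfolding right_minus_eq by (intro all_cong1 eq_commute)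
  also have "\<dots> \<longleftrightarrow> (\<forall>n. \<forall>i\<le>n. \<forall>j\<le>n. a i * a (n - i) = a j * a (n - j))"
    unfolding wn by (subst cmod_sum_square_eq_iff) auto
  also have "\<dots> \<longleftrightarrow> (\<forall>k. a k = 0) \<or> (\<exists>p. a 0 \<noteq> 0 \<and> (\<forall>k. a k = a 0 * p ^ k))"
    by (rule geometric_iff_products_constant)
  finally show "suminf ?c = ?T \<longleftrightarrow> (\<forall>k. a k = 0) \<or> (\<exists>p. a 0 \<noteq> 0 \<and> (\<forall>k. a k = a 0 * p ^ k))" .
qed

subsection \<open>Functions with nonnegative frequencies\<close>

lemma AE_circle_eq_0_iff_Q:
  assumes "f \<in> square_integrable"
  shows "(AE z in circle. f z = 0) \<longleftrightarrow> Q f = 0"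
proof -
  have "Q f = 0 \<longleftrightarrow> (AE z in circle. (cmod (f z))\<^sup>2 = 0)"
    unfolding Q_def
    by (rule integral_nonneg_eq_0_iff_AE[OF square_integrableD(2)[OF assms]]) simp
  then show ?thesis by simp
qed

text \<open>Uniqueness of Fourier coefficients, from Parseval. It later converts almost-everywhere
  identities into identities between coefficients.\<close>

lemma AE_circle_eq_0_iff_fourier_coeff:
  assumes f: "f \<in> square_integrable"
  shows "(AE z in circle. f z = 0) \<longleftrightarrow> (\<forall>k. fourier_coeff f k = 0)"
proof
  assume "AE z in circle. f z = 0"
  then show "\<forall>k. fourier_coeff f k = 0"
    using fourier_coeff_cong_AE[OF square_integrableD(1)[OF f], of "\<lambda>_. 0"]
    by (simp add: fourier_coeff_const)
next
  assume "\<forall>k. fourier_coeff f k = 0"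
  then have "((\<lambda>k::int. 0::real) has_sum Q f) UNIV"
    using Parseval[OF f] by simp
  then have "Q f = 0"
    using has_sum_unique has_sum_0 by (metis (no_types, lifting))
  then show "AE z in circle. f z = 0"
    by (simp add: AE_circle_eq_0_iff_Q[OF f])
qed

lemma has_sum_int_imp_sums:
  fixes g :: "int \<Rightarrow> real"
  assumes "(g has_sum S) UNIV" "\<And>k. k < 0 \<Longrightarrow> g k = 0"
  shows "(\<lambda>n. g (int n)) sums S"
proof -
  have "(g has_sum S) (range int)"
  proof (rule has_sum_cong_neutral[THEN iffD1, OF _ _ _ assms(1)])
    fix k assume "k \<in> UNIV - range int"
    then have "k < 0"
      by (metis DiffD2 nonneg_int_cases not_less range_eqI)
    then show "g k = 0" by (rule assms(2))
  qed auto
  then have "((g \<circ> int) has_sum S) UNIV"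
    by (subst (asm) has_sum_reindex) auto
  then show ?thesis
    using has_sum_imp_sums by (simp add: o_def)
qed

text \<open>Boundary values of the Hardy space H^2 of the disc. The half-derivative condition is
  left out so that u^2, about which only square integrability is known, also qualifies.\<close>

definition Hardy_space :: "(complex \<Rightarrow> complex) set" where
  "Hardy_space = {u \<in> square_integrable. \<forall>k<0. fourier_coeff u k = 0}"

lemma Hardy_spaceD:
  assumes "u \<in> Hardy_space"
  shows "u \<in> square_integrable" "k < 0 \<Longrightarrow> fourier_coeff u k = 0"
  using assms by (auto simp: Hardy_space_def)

lemma Hardy_Parseval:
  assumes "u \<in> Hardy_space"
  shows "(\<lambda>k. (cmod (fourier_coeff u (int k)))\<^sup>2) sums Q u"
  using Parseval[OF Hardy_spaceD(1)[OF assms]] Hardy_spaceD(2)[OF assms]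
  by (intro has_sum_int_imp_sums) auto

section \<open>Partial sums and the Fourier coefficients of a square\<close>

definition fourier_partial_sum :: "(complex \<Rightarrow> complex) \<Rightarrow> nat \<Rightarrow> complex \<Rightarrow> complex" where
  "fourier_partial_sum u N z = (\<Sum>k\<in>{0..int N}. fourier_coeff u k * z powi k)"

lemma sum_atLeastAtMost_int: "(\<Sum>k\<in>{0..int N}. g k) = (\<Sum>k\<le>N. g (int k))"
  by (rule sum.reindex_bij_witness[of _ int nat]) auto

lemma square_integrable_partial_sum: "fourier_partial_sum u N \<in> square_integrable"
  unfolding fourier_partial_sum_def by (rule square_integrable_trig)

lemma fourier_coeff_partial_sum:
  "fourier_coeff (fourier_partial_sum u N) k = (if 0 \<le> k \<and> k \<le> int N then fourier_coeff u k else 0)"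
  unfolding fourier_partial_sum_def by (subst fourier_coeff_trig) auto

lemma Hardy_partial_sum: "fourier_partial_sum u N \<in> Hardy_space"
  by (simp add: Hardy_space_def square_integrable_partial_sum fourier_coeff_partial_sum)

lemma Hardy_partial_sum_tendsto:
  assumes u: "u \<in> Hardy_space"
  shows "(\<lambda>N. Q (\<lambda>z. u z - fourier_partial_sum u N z)) \<longlonglongrightarrow> 0"
proof -
  have eq: "Q (\<lambda>z. u z - fourier_partial_sum u N z)
      = Q u - (\<Sum>k\<le>N. (cmod (fourier_coeff u (int k)))\<^sup>2)" for N
    unfolding fourier_partial_sum_def Q_diff_trig[OF Hardy_spaceD(1)[OF u] finite_atLeastAtMost_int]
    by (simp add: sum_atLeastAtMost_int)
  have "(\<lambda>N. Q u - (\<Sum>k\<le>N. (cmod (fourier_coeff u (int k)))\<^sup>2)) \<longlonglongrightarrow> Q u - Q u"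
    using Hardy_Parseval[OF u] by (intro tendsto_intros) (simp add: sums_def_le)
  then show ?thesis by (simp add: eq)
qed

text \<open>Only one factor of u^2 is replaced by its partial sum; the other stays in
  \<open>v\<close>, which is square integrable. The pairing becomes a finite sum, and Cauchy-Schwarz
  bounds the error by \<open>Q (u - S) * Q v\<close>, with S the partial sum, which tends to
  0.\<close>

lemma fourier_coeff_square:
  assumes u: "u \<in> Hardy_space"
  shows "fourier_coeff (\<lambda>z. u z * u z) m
    = (if m < 0 then 0 else \<Sum>j\<le>nat m. fourier_coeff u (int j) * fourier_coeff u (m - int j))"
    (is "_ = ?c")
proof -
  note ui = Hardy_spaceD(1)[OF u]
  define v where "v = (\<lambda>z. u z * z powi (-m))"
  have v: "v \<in> square_integrable"
    unfolding v_def
    using square_integrable_mult_bounded[OF ui powi_measurable_circle[of "-m"], of 1]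
    by (simp add: cmod_powi_circle mult.commute)
  have near: "(cmod (fourier_coeff (\<lambda>z. u z * u z) m - ?c))\<^sup>2
      \<le> Q (\<lambda>z. u z - fourier_partial_sum u N z) * Q v" if N: "nat m \<le> N" for N
  proof -
    let ?S = "fourier_partial_sum u N"
    have Sv: "(LINT z|circle. ?S z * v z) = (\<Sum>k\<in>{0..int N}. fourier_coeff u k * fourier_coeff u (m - k))"
    proof -
      have pu: "(\<lambda>z. z powi k * u z) \<in> square_integrable" for k
        using square_integrable_mult_bounded[OF ui powi_measurable_circle[of k], of 1]
        by (simp add: cmod_powi_circle)
      have "(LINT z|circle. ?S z * v z)
          = fourier_coeff (\<lambda>z. \<Sum>k\<in>{0..int N}. fourier_coeff u k * (z powi k * u z)) m"
        unfolding fourier_coeff_def[of _ m] fourier_partial_sum_def v_def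
        unfolding sum_distrib_right
        by (intro Bochner_Integration.integral_cong sum.cong refl) (simp only: mult_ac)
      also have "\<dots> = (\<Sum>k\<in>{0..int N}. fourier_coeff u k * fourier_coeff u (m - k))"
        by (subst fourier_coeff_sum)
           (simp_all add: square_integrable_cmult pu fourier_coeff_cmult fourier_coeff_powi_mult)
      finally show ?thesis .
    qed
    also have "\<dots> = ?c"
    proof (cases "m < 0")
      case True
      then show ?thesis
        using Hardy_spaceD(2)[OF u] by (auto intro!: sum.neutral)
    next
      case False
      \<comment> \<open>Terms with k > m contain a coefficient of negative frequency m - k, so from
        N = m on the sum no longer depends on N.\<close>
      have "(\<Sum>k\<in>{0..int N}. fourier_coeff u k * fourier_coeff u (m - k))
          = (\<Sum>k\<in>{0..int (nat m)}. fourier_coeff u k * fourier_coeff u (m - k))"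
        using N False Hardy_spaceD(2)[OF u] by (intro sum.mono_neutral_right) auto
      then show ?thesis
        unfolding sum_atLeastAtMost_int using False by simp
    qed
    finally have Sv: "(LINT z|circle. ?S z * v z) = ?c" .
    have "fourier_coeff (\<lambda>z. u z * u z) m = (LINT z|circle. u z * v z)"
      by (simp add: fourier_coeff_def v_def mult.assoc)
    then have "fourier_coeff (\<lambda>z. u z * u z) m - ?c = (LINT z|circle. (u z - ?S z) * v z)"
      unfolding Sv[symmetric]
      using integrable_mult_square_integrable[OF ui v]
        integrable_mult_square_integrable[OF square_integrable_partial_sum[of u N] v]
      by (simp add: left_diff_distrib)
    then show ?thesis
      using Cauchy_Schwarz_circle[OF square_integrable_diff[OF ui square_integrable_partial_sum] v]
      by simp
  qed
  have "(\<lambda>N. Q (\<lambda>z. u z - fourier_partial_sum u N z) * Q v) \<longlonglongrightarrow> 0 * Q v"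
    by (intro tendsto_intros Hardy_partial_sum_tendsto u)
  then have "(cmod (fourier_coeff (\<lambda>z. u z * u z) m - ?c))\<^sup>2 \<le> 0 * Q v"
    by (rule LIMSEQ_le_const) (use near in blast)
  then show ?thesis by simp
qed

text \<open>\<open>E u\<close> is \<open>Q\<close> of u^2, and \<open>int4\<close> says exactly that
  u^2 is square integrable, so Parseval applies to it.\<close>

lemma E_sums:
  assumes u: "u \<in> Hardy_space" and int4: "integrable circle (\<lambda>z. cmod (u z) ^ 4)"
  shows "(\<lambda>n. (cmod (\<Sum>j\<le>n. fourier_coeff u (int j) * fourier_coeff u (int (n - j))))\<^sup>2) sums E u"
proof -
  note [measurable] = square_integrableD(1)[OF Hardy_spaceD(1)[OF u]]
  have pow: "(cmod (u z * u z))\<^sup>2 = cmod (u z) ^ 4" for z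
    by (simp add: norm_mult power2_eq_square power4_eq_xxxx)
  have "(\<lambda>z. u z * u z) \<in> borel_measurable circle"
    by measurable
  then have "(\<lambda>z. u z * u z) \<in> Hardy_space"
    using int4 by (simp add: Hardy_space_def square_integrable_def pow fourier_coeff_square[OF u])
  from Hardy_Parseval[OF this] show ?thesis
    by (simp add: fourier_coeff_square[OF u] Q_def E_def pow of_nat_diff)
qed

lemma E_le_of_integrable:
  assumes u: "u \<in> Hardy_space" and int4: "integrable circle (\<lambda>z. cmod (u z) ^ 4)"
    and kb: "summable (\<lambda>k. real k * (cmod (fourier_coeff u (int k)))\<^sup>2)"
  shows "E u \<le> Q u * (Q u + 2 * M u)"
    and "E u = Q u * (Q u + 2 * M u) \<longleftrightarrow> (\<forall>k. fourier_coeff u (int k) = 0) \<or>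
      (\<exists>p. fourier_coeff u 0 \<noteq> 0 \<and> (\<forall>k. fourier_coeff u (int k) = fourier_coeff u 0 * p ^ k))"
  using convolution_square_sum(2,3)[of "\<lambda>k. fourier_coeff u (int k)", OF sums_summable[OF Hardy_Parseval[OF u]] kb]
  unfolding sums_unique[OF E_sums[OF u int4], symmetric]
    sums_unique[OF Hardy_Parseval[OF u], symmetric] M_def[symmetric]
  by simp_all

section \<open>Integrability of the fourth power\<close>

lemma bounded_power4_integrable:
  assumes [measurable]: "f \<in> borel_measurable circle" and B: "\<And>z. cmod z = 1 \<Longrightarrow> cmod (f z) \<le> B"
  shows "integrable circle (\<lambda>z. cmod (f z) ^ 4)"
  by (rule circle.integrable_const_bound[of _ "B ^ 4"]) (auto simp: power_mono B)

text \<open>The bound is uniform in \<open>N\<close> because truncating the Fourier series can only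
  decrease \<open>Q\<close> and \<open>M\<close>.\<close>

lemma E_partial_sum_le:
  assumes u: "u \<in> Hardy_space"
    and kb: "summable (\<lambda>k. real k * (cmod (fourier_coeff u (int k)))\<^sup>2)"
  shows "integrable circle (\<lambda>z. cmod (fourier_partial_sum u N z) ^ 4)"
    and "E (fourier_partial_sum u N) \<le> Q u * (Q u + 2 * M u)"
proof -
  let ?S = "fourier_partial_sum u N"
  let ?b = "\<lambda>k. (cmod (fourier_coeff u (int k)))\<^sup>2"
  let ?bS = "\<lambda>k. (cmod (fourier_coeff ?S (int k)))\<^sup>2"
  have bS: "?bS k = (if k \<le> N then ?b k else 0)" for k
    by (simp add: fourier_coeff_partial_sum)
  show int4: "integrable circle (\<lambda>z. cmod (?S z) ^ 4)"
  proof (rule bounded_power4_integrable)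
    fix z :: complex assume z: "cmod z = 1"
    show "cmod (?S z) \<le> (\<Sum>k\<in>{0..int N}. cmod (fourier_coeff u k))"
      unfolding fourier_partial_sum_def
      by (rule sum_norm_le) (simp add: norm_mult cmod_powi_circle[OF z])
  qed (rule square_integrableD(1)[OF square_integrable_partial_sum])
  have kbS: "summable (\<lambda>k. real k * ?bS k)"
    by (rule summable_comparison_test'[OF kb, of 0]) (simp add: bS)
  have "E ?S \<le> Q ?S * (Q ?S + 2 * M ?S)"
    by (rule E_le_of_integrable[OF Hardy_partial_sum int4 kbS])
  also have "\<dots> \<le> Q u * (Q u + 2 * M u)"
  proof -
    have "Q ?S \<le> Q u"
      unfolding sums_unique[OF Hardy_Parseval[OF u]] sums_unique[OF Hardy_Parseval[OF Hardy_partial_sum]]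
      using sums_summable[OF Hardy_Parseval[OF u]] sums_summable[OF Hardy_Parseval[OF Hardy_partial_sum]]
      by (intro suminf_le) (simp_all add: fourier_coeff_partial_sum)
    moreover have "M ?S \<le> M u"
      unfolding M_def by (intro suminf_le kb kbS) (simp add: bS)
    moreover have "M ?S \<ge> 0"
      unfolding M_def by (intro suminf_nonneg kbS) simp
    ultimately show ?thesis
      using Q_nonneg[of ?S] by (intro mult_mono add_mono mult_left_mono) auto
  qed
  finally show "E ?S \<le> Q u * (Q u + 2 * M u)" .
qed

lemma Hardy_power4_integrable:
  assumes u: "u \<in> Hardy_space"
    and kb: "summable (\<lambda>k. real k * (cmod (fourier_coeff u (int k)))\<^sup>2)"
  shows "integrable circle (\<lambda>z. cmod (u z) ^ 4)"
proof -
  let ?S = "fourier_partial_sum u"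
  let ?C = "Q u * (Q u + 2 * M u)"
  note ui = Hardy_spaceD(1)[OF u]
  note [measurable] = square_integrableD(1)[OF ui] square_integrableD(1)[OF square_integrable_partial_sum]
  have diff_int: "integrable circle (\<lambda>z. (cmod (u z - ?S N z))\<^sup>2)" for N
    using square_integrable_diff[OF ui square_integrable_partial_sum] by (rule square_integrableD(2))
  have "(\<lambda>N. LINT z|circle. norm ((cmod (u z - ?S N z))\<^sup>2)) \<longlonglongrightarrow> 0"
    using Hardy_partial_sum_tendsto[OF u] by (simp add: Q_def)
  \<comment> \<open>L^2 convergence yields pointwise convergence only along a subsequence, which is
    enough for Fatou.\<close>
  then obtain r :: "nat \<Rightarrow> nat"
    where "AE z in circle. (\<lambda>n. (cmod (u z - ?S (r n) z))\<^sup>2) \<longlonglongrightarrow> 0"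
    using tendsto_L1_AE_subseq[of circle "\<lambda>N z. (cmod (u z - ?S N z))\<^sup>2", OF diff_int] by blast
  then have lim: "AE z in circle. (\<lambda>n. ennreal (cmod (?S (r n) z) ^ 4)) \<longlonglongrightarrow> ennreal (cmod (u z) ^ 4)"
  proof eventually_elim
    case (elim z)
    then have "(\<lambda>n. sqrt ((cmod (u z - ?S (r n) z))\<^sup>2)) \<longlonglongrightarrow> sqrt 0"
      by (rule tendsto_real_sqrt)
    then have "(\<lambda>n. u z - ?S (r n) z) \<longlonglongrightarrow> 0"
      by (simp add: tendsto_norm_zero_iff)
    from tendsto_diff[OF tendsto_const[of "u z"] this]
    have "(\<lambda>n. ?S (r n) z) \<longlonglongrightarrow> u z" by simp
    then show ?case
      by (intro tendsto_ennrealI tendsto_intros)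
  qed
  have "(\<integral>\<^sup>+z. ennreal (cmod (u z) ^ 4) \<partial>circle)
      = (\<integral>\<^sup>+z. liminf (\<lambda>n. ennreal (cmod (?S (r n) z) ^ 4)) \<partial>circle)"
  proof (rule nn_integral_cong_AE)
    show "AE z in circle. ennreal (cmod (u z) ^ 4) = liminf (\<lambda>n. ennreal (cmod (?S (r n) z) ^ 4))"
      using lim by eventually_elim (simp only: lim_imp_Liminf[OF sequentially_bot])
  qed
  also have "\<dots> \<le> liminf (\<lambda>n. \<integral>\<^sup>+z. ennreal (cmod (?S (r n) z) ^ 4) \<partial>circle)"
    by (intro nn_integral_liminf) measurable
  also have "(\<lambda>n. \<integral>\<^sup>+z. ennreal (cmod (?S (r n) z) ^ 4) \<partial>circle) = (\<lambda>n. ennreal (E (?S (r n))))"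
    unfolding E_def using E_partial_sum_le(1)[OF u kb]
    by (intro ext nn_integral_eq_integral) auto
  also have "liminf (\<lambda>n. ennreal (E (?S (r n)))) \<le> liminf (\<lambda>n. ennreal ?C)"
    using E_partial_sum_le(2)[OF u kb] by (intro Liminf_mono always_eventually) (auto intro!: ennreal_leI)
  also have "\<dots> < \<infinity>"
    by (simp add: Liminf_const)
  finally show ?thesis
    by (intro integrableI_bounded) simp_all
qed

text \<open>Multiplying by \<open>1 - p z\<close> turns membership in \<^const>\<open>M_one\<close> into the recurrence
  \<open>a\<^sub>k = p a\<^sub>k\<^sub>-\<^sub>1\<close>, with \<open>a\<^sub>0 = \<alpha>\<close>.\<close>

lemma M_one_iff_fourier_coeff:
  assumes u: "u \<in> Hardy_space"
  shows "u \<in> M_one \<longleftrightarrow>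
    (\<exists>p. fourier_coeff u 0 \<noteq> 0 \<and> (\<forall>k. fourier_coeff u (int k) = fourier_coeff u 0 * p ^ k))"
proof -
  note ui = Hardy_spaceD(1)[OF u]
  \<comment> \<open>z is written \<open>z powi 1\<close> so that the product is a frequency shift in
    the sense of \<open>fourier_coeff_powi_mult\<close>.\<close>
  have pz: "(\<lambda>z. p * (z powi 1 * u z)) \<in> square_integrable" for p
    using square_integrable_mult_bounded[OF ui powi_measurable_circle[of 1], of 1]
    by (intro square_integrable_cmult) (simp add: cmod_powi_circle)
  have vi: "(\<lambda>z. u z - p * (z powi 1 * u z) - \<alpha>) \<in> square_integrable" for p \<alpha>
    by (intro square_integrable_diff square_integrable_const ui pz)
  have coeff: "fourier_coeff (\<lambda>z. u z - p * (z powi 1 * u z) - \<alpha>) k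
      = fourier_coeff u k - p * fourier_coeff u (k - 1) - (if k = 0 then \<alpha> else 0)" for p \<alpha> k
    using fourier_coeff_diff[OF square_integrable_diff[OF ui pz] square_integrable_const]
      fourier_coeff_diff[OF ui pz]
    by (simp only: fourier_coeff_const fourier_coeff_cmult fourier_coeff_powi_mult)
  have AE_iff: "(AE z in circle. u z = \<alpha> / (1 - p * z))
      \<longleftrightarrow> (\<forall>k. fourier_coeff u (int k) = \<alpha> * p ^ k)" if p: "cmod p < 1" for p \<alpha>
  proof -
    have "(AE z in circle. u z = \<alpha> / (1 - p * z))
        \<longleftrightarrow> (AE z in circle. u z - p * (z powi 1 * u z) - \<alpha> = 0)"
    proof (rule AE_cong)
      fix z assume "z \<in> space circle"
      then have "cmod (p * z) \<noteq> 1" using p by (simp add: norm_mult)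
      then have "1 - p * z \<noteq> 0" by auto
      then show "u z = \<alpha> / (1 - p * z) \<longleftrightarrow> u z - p * (z powi 1 * u z) - \<alpha> = 0"
        by (auto simp: field_simps)
    qed
    also have "\<dots> \<longleftrightarrow> (\<forall>k. fourier_coeff u k = p * fourier_coeff u (k - 1) + (if k = 0 then \<alpha> else 0))"
      unfolding AE_circle_eq_0_iff_fourier_coeff[OF vi] coeff by (auto simp: algebra_simps)
    \<comment> \<open>The recurrence runs over all integers: both sides vanish for negative
      \<open>k\<close>, and at \<open>k = 0\<close> the vanishing coefficient at -1 leaves the
      initial value \<alpha>.\<close>
    also have "\<dots> \<longleftrightarrow> (\<forall>k. fourier_coeff u (int k) = \<alpha> * p ^ k)" (is "?L \<longleftrightarrow> ?R")
    proof
      assume L: ?L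
      have "fourier_coeff u (int k) = \<alpha> * p ^ k" for k
      proof (induction k)
        case 0
        show ?case using L[rule_format, of 0] Hardy_spaceD(2)[OF u, of "-1"] by simp
      next
        case (Suc k)
        then show ?case using L[rule_format, of "int (Suc k)"] by simp
      qed
      then show ?R by blast
    next
      assume R: ?R
      show ?L
      proof
        fix k :: int
        consider "k < 0" | "k = 0" | n where "k = int (Suc n)"
          by (metis linorder_neqE_linordered_idom zero_less_imp_eq_int gr0_conv_Suc of_nat_0_less_iff)
        then show "fourier_coeff u k = p * fourier_coeff u (k - 1) + (if k = 0 then \<alpha> else 0)"
        proof cases
          case 1
          then show ?thesis using Hardy_spaceD(2)[OF u, of k] Hardy_spaceD(2)[OF u, of "k - 1"] by simp
        next
          case 2
          then show ?thesis using R[rule_format, of 0] Hardy_spaceD(2)[OF u, of "-1"] by simp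
        next
          case (3 n)
          then show ?thesis using R[rule_format, of "Suc n"] R[rule_format, of n] by simp
        qed
      qed
    qed
    finally show ?thesis .
  qed
  \<comment> \<open>The geometric form says nothing about the size of \<open>p\<close>; with a
    nonzero first coefficient, square summability forces it into the open disc.\<close>
  have p_less: "cmod p < 1"
    if "fourier_coeff u 0 \<noteq> 0" "\<forall>k. fourier_coeff u (int k) = fourier_coeff u 0 * p ^ k" for p
  proof -
    have "summable (\<lambda>k. (cmod (fourier_coeff u (int k)))\<^sup>2)"
      using Hardy_Parseval[OF u] by (rule sums_summable)
    also have "(\<lambda>k. (cmod (fourier_coeff u (int k)))\<^sup>2)
        = (\<lambda>k. (cmod (fourier_coeff u 0))\<^sup>2 * ((cmod p)\<^sup>2) ^ k)"
    proof
      fix k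
      show "(cmod (fourier_coeff u (int k)))\<^sup>2 = (cmod (fourier_coeff u 0))\<^sup>2 * ((cmod p)\<^sup>2) ^ k"
        unfolding that(2)[rule_format, of k]
        by (simp add: norm_mult norm_power power_mult_distrib mult.commute flip: power_mult)
    qed
    finally have "summable (\<lambda>k. ((cmod p)\<^sup>2) ^ k)"
      using that(1) by simp
    then have "(cmod p)\<^sup>2 < 1"
      by (simp add: summable_geometric_iff)
    then show ?thesis
      by (simp add: power_less_one_iff abs_square_less_1)
  qed
  show ?thesis
  proof
    assume "u \<in> M_one"
    then obtain \<alpha> p where "\<alpha> \<noteq> 0" "cmod p < 1" "AE z in circle. u z = \<alpha> / (1 - p * z)"
      by (auto simp: M_one_def)
    then have "\<forall>k. fourier_coeff u (int k) = \<alpha> * p ^ k"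
      using AE_iff by blast
    with \<open>\<alpha> \<noteq> 0\<close> show "\<exists>p. fourier_coeff u 0 \<noteq> 0 \<and>
        (\<forall>k. fourier_coeff u (int k) = fourier_coeff u 0 * p ^ k)"
      by (metis mult_1_right of_nat_0 power_0)
  next
    assume "\<exists>p. fourier_coeff u 0 \<noteq> 0 \<and>
        (\<forall>k. fourier_coeff u (int k) = fourier_coeff u 0 * p ^ k)"
    then show "u \<in> M_one"
      unfolding M_one_def using AE_iff p_less by blast
  qed
qed

text \<open>Positive \<open>n\<close> makes the two integrands agree where \<open>u\<close>
  vanishes, since \<open>0 powr 0\<close> is 0 whereas \<open>0 ^ 0\<close> is 1.\<close>

lemma Lp_norm_power:
  assumes "n > 0"
  shows "Lp_norm (real n) u ^ n = (LINT z|circle. cmod (u z) ^ n)"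
proof -
  have "(LINT z|circle. cmod (u z) powr real n) = (LINT z|circle. cmod (u z) ^ n)"
    using assms by (simp add: powr_realpow')
  moreover have "(LINT z|circle. cmod (u z) ^ n) \<ge> 0"
    by simp
  ultimately show ?thesis
    using assms
    by (cases "(LINT z|circle. cmod (u z) ^ n) = 0") (simp_all add: Lp_norm_def powr_power)
qed

text \<open>Integrability is part of the conclusion because a non-integrable function has integral 0
  by convention, which would make the bound on \<open>E u\<close> empty. Equality also holds for the
  zero function, which is not in \<open>M_one\<close> as \<alpha> is nonzero there. Since the
  squared \<open>H_half_norm\<close> is M + Q, the factor Q + 2 M is twice that square minus the
  squared L^2 norm; the sum of the two squares, 2 Q + M, would give a bound violated by 1 / (1 - p
  z) once |p|^2 > 1/2.\<close>

theorem proposition5: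
  fixes u :: "complex \<Rightarrow> complex"
  assumes "u \<in> H_half_plus"
  shows "integrable circle (\<lambda>z. cmod (u z) ^ 4) \<and>
    E u \<le> Q u * (Q u + 2 * M u) \<and>
    Lp_norm 4 u ^ 4 \<le> (Lp_norm 2 u)\<^sup>2 * (2 * (H_half_norm u)\<^sup>2 - (Lp_norm 2 u)\<^sup>2) \<and>
    (E u = Q u * (Q u + 2 * M u) \<longleftrightarrow> u \<in> M_one \<or> (AE z in circle. u z = 0)) \<and>
    (Lp_norm 4 u ^ 4 = (Lp_norm 2 u)\<^sup>2 * (2 * (H_half_norm u)\<^sup>2 - (Lp_norm 2 u)\<^sup>2)
      \<longleftrightarrow> u \<in> M_one \<or> (AE z in circle. u z = 0))"
proof -
  have u: "u \<in> Hardy_space"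
    and Hs: "(\<lambda>k::int. (1 + \<bar>real_of_int k\<bar>) * (cmod (fourier_coeff u k))\<^sup>2) summable_on UNIV"
    using assms by (auto simp: H_half_plus_def H_half_def Hardy_space_def square_integrable_def)
  have b: "summable (\<lambda>k. (cmod (fourier_coeff u (int k)))\<^sup>2)"
    using Hardy_Parseval[OF u] by (rule sums_summable)
  obtain S where "((\<lambda>k::int. (1 + \<bar>real_of_int k\<bar>) * (cmod (fourier_coeff u k))\<^sup>2) has_sum S) UNIV"
    using Hs by (auto simp: summable_on_def)
  then have "(\<lambda>n. (1 + \<bar>real_of_int (int n)\<bar>) * (cmod (fourier_coeff u (int n)))\<^sup>2) sums S"
    using Hardy_spaceD(2)[OF u] by (intro has_sum_int_imp_sums) auto
  then have "summable (\<lambda>n. (1 + real n) * (cmod (fourier_coeff u (int n)))\<^sup>2)"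
    by (simp add: sums_iff)
  from summable_diff[OF this b]
  have kb: "summable (\<lambda>k. real k * (cmod (fourier_coeff u (int k)))\<^sup>2)"
    by (simp add: algebra_simps)
  note int4 = Hardy_power4_integrable[OF u kb]
  have "(\<forall>k. fourier_coeff u k = 0) \<longleftrightarrow> (\<forall>k. fourier_coeff u (int k) = 0)"
    using Hardy_spaceD(2)[OF u] by (metis nonneg_int_cases not_less)
  then have zero: "(AE z in circle. u z = 0) \<longleftrightarrow> (\<forall>k. fourier_coeff u (int k) = 0)"
    using AE_circle_eq_0_iff_fourier_coeff[OF Hardy_spaceD(1)[OF u]] by simp
  have eq: "E u = Q u * (Q u + 2 * M u) \<longleftrightarrow> u \<in> M_one \<or> (AE z in circle. u z = 0)"
    unfolding E_le_of_integrable(2)[OF u int4 kb] M_one_iff_fourier_coeff[OF u] zero by blast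
  have L4: "Lp_norm 4 u ^ 4 = E u" and L2: "(Lp_norm 2 u)\<^sup>2 = Q u"
    using Lp_norm_power[of 4 u] Lp_norm_power[of 2 u] by (simp_all add: E_def Q_def)
  have "(\<lambda>k. real k * (cmod (fourier_coeff u (int k)))\<^sup>2 + (cmod (fourier_coeff u (int k)))\<^sup>2)
      sums (M u + Q u)"
    unfolding M_def by (intro sums_add summable_sums kb Hardy_Parseval u)
  then have "(\<Sum>k. (real k + 1) * (cmod (fourier_coeff u (int k)))\<^sup>2) = M u + Q u"
    by (simp add: sums_iff distrib_right)
  moreover have "M u \<ge> 0"
    unfolding M_def by (intro suminf_nonneg kb) simp
  ultimately have H: "(H_half_norm u)\<^sup>2 = M u + Q u"
    by (simp add: H_half_norm_def Q_nonneg)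
  show ?thesis
    using int4 E_le_of_integrable(1)[OF u int4 kb] eq
    unfolding L4 L2 H by (simp add: algebra_simps)
qed

end
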